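(* Assume that (1) $\mathbb{E}[|\mathbf{X}|^2]\le pK$ and $\|f\|_\infty\le C$ for some constants $K,C\ge 1$; and (2) there are constants $\sigma,\Gamma>0$ such that $\mathbb{E}[|\varepsilon|^k\mid \mathbf{X}]\le \frac{k!}{2}\sigma^2\Gamma^{k-2}$ almost surely for all integers $k\ge 2$. Then there are constants $\Xi_0,\Xi_1>0$ depending only on $C,\Gamma,\sigma$ such that, for $\lambda=n/\Xi_0$ and all sufficiently large $n$, for every $\delta\in(0,1)$ it holds with probability at least $1-\delta$ that \[ \mathcal{E}(\hat f_\lambda)\le \min_{\mathcal{I}}\Big(4\,\mathcal{E}(f_{\theta^*_{\mathcal{I}}})+\frac{\Xi_1}{n}\big(|\mathcal{I}|\,L\log(p\vee n)+\log(2/\delta)\big)\Big), \] where the minimum is over all nonempty $\mathcal{I}\subseteq\{1,\dots,P\}$.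
   Context: Data: $\mathcal{D}_n=(\mathbf{X}_i,Y_i)_{i=1,\dots,n}$ are i.i.d. copies of $(\mathbf{X},Y)\in\mathbb{R}^p\times\mathbb{R}$ with $Y=f(\mathbf{X})+\varepsilon$ and $\mathbb{E}[\varepsilon\mid\mathbf{X}]=0$ a.s. For a function $g$, $R(g)=\mathbb{E}[(Y-g(\mathbf{X}))^2]$, $R_n(g)=\frac1n\sum_{i=1}^n(Y_i-g(\mathbf{X}_i))^2$, and the excess risk is $\mathcal{E}(g)=R(g)-R(f)=\|g-f\|^2_{L^2(\mathbb{P}^{\mathbf{X}})}$. Networks: with $\sigma(x)=\max(x,0)$ applied coordinatewise and $L,r\in\mathbb{N}$, let $g_\theta(\mathbf{x})=W^{(L+1)}\mathbf{x}^{(L)}+v^{(L+1)}$ where $\mathbf{x}^{(0)}=\mathbf{x}\in\mathbb{R}^p$, $\mathbf{x}^{(l)}=\sigma(W^{(l)}\mathbf{x}^{(l-1)}+v^{(l)})$ for $l=1,\dots,L$, with $W^{(1)}\in\mathbb{R}^{r\times p}$, $W^{(2)},\dots,W^{(L)}\in\mathbb{R}^{r\times r}$, $W^{(L+1)}\in\mathbb{R}^{1\times r}$, $v^{(1)},\dots,v^{(L)}\in\mathbb{R}^r$, $v^{(L+1)}\in\mathbb{R}$, all entries collected in $\theta\in\mathbb{R}^P$, $P=(p+1)r+(L-1)(r+1)r+r+1$. The clipped network is $f_\theta=(-C)\vee(g_\theta\wedge C)$; write $R(\theta)=R(f_\theta)$, $R_n(\theta)=R_n(f_\theta)$. Prior: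 fix $B\ge1$. For $\mathcal{I}\subseteq\{1,\dots,P\}$ let $\mathcal{S}_{\mathcal{I}}=\{\theta\in[-B,B]^P:\theta_i=0\text{ for }i\notin\mathcal{I}\}$ and $\Pi_{\mathcal{I}}$ the uniform distribution on $\mathcal{S}_{\mathcal{I}}$ (uniform in the coordinates in $\mathcal{I}$, others zero). The prior is $\Pi=\sum_{i=1}^P 2^{-i}\sum_{|\mathcal{I}|=i}\binom{P}{i}^{-1}\Pi_{\mathcal{I}}/C_P$ with $C_P=1-2^{-P}$. Gibbs posterior: $\Pi_\lambda(d\theta\mid\mathcal{D}_n)\propto\exp(-\lambda R_n(\theta))\Pi(d\theta)$ for $\lambda>0$; the estimator is $\hat f_\lambda=f_{\hat\theta_\lambda}$ with $\hat\theta_\lambda\mid\mathcal{D}_n\sim\Pi_\lambda(\cdot\mid\mathcal{D}_n)$. The probability is with respect to both the data and the posterior draw. Oracle: $\theta^*_{\mathcal{I}}\in\arg\min_{\theta\in\mathcal{S}_{\mathcal{I}}}R(\theta)$. *)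

theory Defs
  imports "HOL-Probability.Probability"
begin

definition input_space :: "nat \<Rightarrow> (nat \<Rightarrow> real) measure" where
  "input_space p = PiM {..<p} (\<lambda>_. borel)"

definition relu :: "real \<Rightarrow> real" where
  "relu t = max t 0"

text \<open>Indices of the network parameters (the P coordinates of theta):
  W1 k j = entry (k,j) of W^(1);  V1 k = entry k of v^(1);
  Wh l k k' = entry (k,k') of W^(l) (2 <= l <= L);  Vh l k = entry k of v^(l);
  Wo k = entry k of W^(L+1);  Vo = v^(L+1).  Indices k,k' < r, j < p.\<close>

datatype pidx = W1 nat nat | V1 nat | Wh nat nat nat | Vh nat nat | Wo nat | Vo

definition param_idx :: "nat \<Rightarrow> nat \<Rightarrow> nat \<Rightarrow> pidx set" where
  "param_idx p r L =
     {W1 k j | k j. k < r \<and> j < p} \<union> {V1 k | k. k < r} \<union>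
     {Wh l k k' | l k k'. 2 \<le> l \<and> l \<le> L \<and> k < r \<and> k' < r} \<union>
     {Vh l k | l k. 2 \<le> l \<and> l \<le> L \<and> k < r} \<union>
     {Wo k | k. k < r} \<union> {Vo}"

definition num_params :: "nat \<Rightarrow> nat \<Rightarrow> nat \<Rightarrow> nat" where
  "num_params p r L = (p + 1) * r + (L - 1) * (r + 1) * r + r + 1"

text \<open>hidden p r theta x m = x^(m+1), the (m+1)-th hidden layer (a vector indexed by k < r).\<close>
fun hidden :: "nat \<Rightarrow> nat \<Rightarrow> (pidx \<Rightarrow> real) \<Rightarrow> (nat \<Rightarrow> real) \<Rightarrow> nat \<Rightarrow> (nat \<Rightarrow> real)" where
  "hidden p r \<theta> x 0 = (\<lambda>k. relu ((\<Sum>j<p. \<theta> (W1 k j) * x j) + \<theta> (V1 k)))"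
| "hidden p r \<theta> x (Suc m) =
     (\<lambda>k. relu ((\<Sum>k'<r. \<theta> (Wh (m + 2) k k') * hidden p r \<theta> x m k') + \<theta> (Vh (m + 2) k)))"

definition net :: "nat \<Rightarrow> nat \<Rightarrow> nat \<Rightarrow> (pidx \<Rightarrow> real) \<Rightarrow> (nat \<Rightarrow> real) \<Rightarrow> real" where
  "net p r L \<theta> x = (\<Sum>k<r. \<theta> (Wo k) * hidden p r \<theta> x (L - 1) k) + \<theta> Vo"

definition clipped_net :: "real \<Rightarrow> nat \<Rightarrow> nat \<Rightarrow> nat \<Rightarrow> (pidx \<Rightarrow> real) \<Rightarrow> (nat \<Rightarrow> real) \<Rightarrow> real" where
  "clipped_net C p r L \<theta> x = max (- C) (min (net p r L \<theta> x) C)"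

definition risk :: "((nat \<Rightarrow> real) \<times> real) measure \<Rightarrow> ((nat \<Rightarrow> real) \<Rightarrow> real) \<Rightarrow> real" where
  "risk D g = (\<integral>z. (snd z - g (fst z))\<^sup>2 \<partial>D)"

definition excess_risk ::
  "((nat \<Rightarrow> real) \<times> real) measure \<Rightarrow> ((nat \<Rightarrow> real) \<Rightarrow> real) \<Rightarrow> ((nat \<Rightarrow> real) \<Rightarrow> real) \<Rightarrow> real" where
  "excess_risk D f g = risk D g - risk D f"

definition emp_risk :: "nat \<Rightarrow> (nat \<Rightarrow> (nat \<Rightarrow> real) \<times> real) \<Rightarrow> ((nat \<Rightarrow> real) \<Rightarrow> real) \<Rightarrow> real" where
  "emp_risk n S g = (1 / real n) * (\<Sum>i<n. (snd (S i) - g (fst (S i)))\<^sup>2)"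

definition param_space :: "nat \<Rightarrow> nat \<Rightarrow> nat \<Rightarrow> (pidx \<Rightarrow> real) measure" where
  "param_space p r L = PiM (param_idx p r L) (\<lambda>_. borel)"

definition support_set :: "real \<Rightarrow> nat \<Rightarrow> nat \<Rightarrow> nat \<Rightarrow> pidx set \<Rightarrow> (pidx \<Rightarrow> real) set" where
  "support_set B p r L I =
     {\<theta> \<in> space (param_space p r L).
        (\<forall>i \<in> param_idx p r L. \<bar>\<theta> i\<bar> \<le> B \<and> (i \<notin> I \<longrightarrow> \<theta> i = 0))}"

definition prior_I :: "real \<Rightarrow> nat \<Rightarrow> nat \<Rightarrow> nat \<Rightarrow> pidx set \<Rightarrow> (pidx \<Rightarrow> real) measure" where
  "prior_I B p r L I =
     PiM (param_idx p r L)
       (\<lambda>i. if i \<in> I then uniform_measure lborel {-B..B} else return borel 0)"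

definition prior :: "real \<Rightarrow> nat \<Rightarrow> nat \<Rightarrow> nat \<Rightarrow> (pidx \<Rightarrow> real) measure" where
  "prior B p r L =
     (let P = num_params p r L; CP = 1 - 2 powr (- real P) in
      measure_of (space (param_space p r L)) (sets (param_space p r L))
        (\<lambda>A. \<Sum>i\<in>{1..P}. ennreal (2 powr (- real i)) *
               (\<Sum>I\<in>{I. I \<subseteq> param_idx p r L \<and> card I = i}.
                   ennreal (1 / (real (P choose i) * CP)) * emeasure (prior_I B p r L I) A)))"

definition gibbs_posterior ::
  "real \<Rightarrow> real \<Rightarrow> nat \<Rightarrow> nat \<Rightarrow> nat \<Rightarrow> real \<Rightarrow> nat \<Rightarrow> (nat \<Rightarrow> (nat \<Rightarrow> real) \<times> real)
     \<Rightarrow> (pidx \<Rightarrow> real) measure" where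
  "gibbs_posterior C B p r L lam n S =
     (let Z = (\<integral>\<theta>. exp (- lam * emp_risk n S (clipped_net C p r L \<theta>)) \<partial>prior B p r L) in
      density (prior B p r L)
        (\<lambda>\<theta>. ennreal (exp (- lam * emp_risk n S (clipped_net C p r L \<theta>)) / Z)))"

end

theory Submission
  imports Defs
begin

text \<open>
  With \<open>\<lambda> = n / \<Xi>\<^sub>0\<close>, Bernstein's condition gives for every fixed network and both signs
  \<open>E exp (\<plusminus> \<lambda> (R\<^sub>n(\<theta>) - R\<^sub>n(f))) \<le> exp (\<lambda> (\<plusminus> \<E>(\<theta>) + \<E>(\<theta>) / 3))\<close>, and Fubini carries these bounds over to
  averages against the prior.  By Cauchy-Schwarz the normalising constant \<open>Z\<close> of the posterior satisfies
  \<open>1 / Z \<le> \<Pi>(A)\<^sup>-\<^sup>2 \<integral>\<^sub>A exp (\<lambda> R\<^sub>n) d\<Pi>\<close> for every set \<open>A\<close>.  Hence the posterior mass of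
  \<open>{\<E> > b}\<close> is at most \<open>1\<close> and at most \<open>\<delta>\<^sup>2 U V\<close> with \<open>E U \<le> 1\<close> and \<open>E V \<le> 1\<close>, provided \<open>b\<close> exceeds
  \<open>2 sup\<^sub>A \<E>\<close> by a multiple of \<open>(log (1 / \<Pi>(A)) + log (1 / \<delta>)) / n\<close>; being at most
  \<open>\<delta> (U + V) / 2\<close>, it has mean at most \<open>\<delta>\<close>.  The oracle bound is deterministic, so it suffices to treat
  the single index set \<open>I\<close> attaining the minimum, with \<open>A\<close> the box of radius \<open>1 / n\<close> around its oracle: there
  \<open>log (1 / \<Pi>(A)) \<le> 2 |I| log n\<close> for large \<open>n\<close>, and networks are Lipschitz in the parameters, so
  \<open>sup\<^sub>A \<E> \<le> 2 \<E>(\<theta>\<^sup>*) + 1 / n\<close>.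
\<close>

section \<open>Exponential moments under a conditional Bernstein condition\<close>

text \<open>Isolates the terms of order at least two, the ones a moment condition controls. The two
  lowest orders are handled by integrability and by the conditional mean.\<close>

lemma exp_second_order_sums:
  fixes x :: real
  shows "(\<lambda>k. x ^ (k + 2) / fact (k + 2)) sums (exp x - 1 - x)"
proof -
  have "(\<lambda>k. x ^ k / fact k) sums exp x"
    using exp_converges[of x] by (simp add: scaleR_conv_of_real divide_inverse mult.commute)
  from sums_split_initial_segment[OF this, of 2] show ?thesis
    by (simp add: numeral_2_eq_2 algebra_simps)
qed

context finite_measure_subalgebra
begin

text \<open>A bounded \<open>F\<close>-measurable factor passes through the conditional expectation,
  and its sign keeps the inequality when \<open>c\<close> is inserted.\<close>

lemma integral_mult_cond_exp_le:
  fixes a e :: "'a \<Rightarrow> real"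
  assumes [measurable]: "a \<in> borel_measurable F" and int: "integrable M e"
    and a: "\<And>z. 0 \<le> a z" "\<And>z. a z \<le> A"
    and le: "AE z in M. real_cond_exp M F e z \<le> c"
  shows "integrable M (\<lambda>z. a z * e z)" and "(\<integral>z. a z * e z \<partial>M) \<le> c * (\<integral>z. a z \<partial>M)"
proof -
  have aM [measurable]: "a \<in> borel_measurable M"
    by (rule measurable_from_subalg[OF subalg]) fact
  have [measurable]: "e \<in> borel_measurable M" using int by simp
  have inta: "integrable M a"
    by (rule integrable_const_bound[of _ A]) (use a in auto)
  show int2: "integrable M (\<lambda>z. a z * e z)"
  proof (rule Bochner_Integration.integrable_bound[of M "\<lambda>z. A * e z"])
    show "AE z in M. norm (a z * e z) \<le> norm (A * e z)"
      using a by (auto simp: abs_mult intro!: mult_right_mono order_trans[OF a(2) abs_ge_self])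
  qed (use int in auto)
  have "(\<integral>z. a z * e z \<partial>M) = (\<integral>z. a z * real_cond_exp M F e z \<partial>M)"
    using real_cond_exp_intg(2)[OF int2] by simp
  also have "\<dots> \<le> (\<integral>z. a z * c \<partial>M)"
  proof (rule integral_mono_AE)
    show "AE z in M. a z * real_cond_exp M F e z \<le> a z * c"
      using le by eventually_elim (use a in \<open>auto intro: mult_left_mono\<close>)
  qed (use real_cond_exp_intg(1)[OF int2] inta in auto)
  also have "\<dots> = c * (\<integral>z. a z \<partial>M)" by simp
  finally show "(\<integral>z. a z * e z \<partial>M) \<le> c * (\<integral>z. a z \<partial>M)" .
qed

text \<open>Orthogonality of noise to functions of the input. It removes both the linear term of the
  exponential series and the cross term in the decomposition of the risk.\<close>

lemma integral_mult_cond_mean_zero: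
  fixes a e :: "'a \<Rightarrow> real"
  assumes [measurable]: "a \<in> borel_measurable F" and int: "integrable M e"
    and a: "\<And>z. \<bar>a z\<bar> \<le> A"
    and zero: "AE z in M. real_cond_exp M F e z = 0"
  shows "integrable M (\<lambda>z. a z * e z)" and "(\<integral>z. a z * e z \<partial>M) = 0"
proof -
  have [measurable]: "a \<in> borel_measurable M"
    by (rule measurable_from_subalg[OF subalg]) fact
  have [measurable]: "e \<in> borel_measurable M" using int by simp
  show int2: "integrable M (\<lambda>z. a z * e z)"
  proof (rule Bochner_Integration.integrable_bound[of M "\<lambda>z. A * e z"])
    show "AE z in M. norm (a z * e z) \<le> norm (A * e z)"
      by (auto simp: abs_mult intro!: mult_right_mono order_trans[OF a abs_ge_self])
  qed (use int in auto)
  have "(\<integral>z. a z * e z \<partial>M) = (\<integral>z. a z * real_cond_exp M F e z \<partial>M)"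
    using real_cond_exp_intg(2)[OF int2] by simp
  also have "\<dots> = (\<integral>z. 0 \<partial>M)"
    by (rule integral_cong_AE) (use zero in auto)
  finally show "(\<integral>z. a z * e z \<partial>M) = 0" by simp
qed

text \<open>Expand the exponential as a power series. The linear term vanishes, and in the term of
  order k + 2 the factorial cancels against the moment condition, leaving a geometric series in
  \<open>T * \<Gamma>\<close>. The weight \<open>a\<close> is carried along because a loss
  difference also contains a factor depending on the input alone.\<close>

lemma integral_exp_mult_le_of_bernstein:
  fixes a s eps :: "'a \<Rightarrow> real"
  assumes aF [measurable]: "a \<in> borel_measurable F" and sF [measurable]: "s \<in> borel_measurable F"
    and a: "\<And>z. 0 \<le> a z" "\<And>z. a z \<le> A" and s: "\<And>z. \<bar>s z\<bar> \<le> T"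
    and T: "T * \<Gamma> \<le> 1 / 2" and \<Gamma>: "\<Gamma> > 0"
    and int1: "integrable M eps" and mean: "AE z in M. real_cond_exp M F eps z = 0"
    and intk: "\<And>k. k \<ge> 2 \<Longrightarrow> integrable M (\<lambda>z. \<bar>eps z\<bar> ^ k)"
    and mom: "\<And>k. k \<ge> 2 \<Longrightarrow> AE z in M. real_cond_exp M F (\<lambda>z. \<bar>eps z\<bar> ^ k) z
                  \<le> fact k / 2 * \<sigma>\<^sup>2 * \<Gamma> ^ (k - 2)"
  shows "integrable M (\<lambda>z. a z * exp (s z * eps z))"
    and "(\<integral>z. a z * exp (s z * eps z) \<partial>M) \<le> (\<integral>z. a z * (1 + (s z)\<^sup>2 * \<sigma>\<^sup>2) \<partial>M)"
proof -
  have [measurable]: "a \<in> borel_measurable M" "s \<in> borel_measurable M"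
    by (auto intro: measurable_from_subalg[OF subalg])
  have [measurable]: "eps \<in> borel_measurable M" using int1 by simp
  have T0: "0 \<le> T" using s[of undefined] by linarith
  have A0: "0 \<le> A" using a[of undefined] by linarith
  have inta: "integrable M a"
    by (rule integrable_const_bound[of _ A]) (use a in auto)
  have s2: "(s z)\<^sup>2 \<le> T\<^sup>2" for z
    using power_mono[OF s[of z] abs_ge_zero, of 2] by simp
  have as2: "\<bar>a z * (s z)\<^sup>2\<bar> \<le> A * T\<^sup>2" for z
    using a[of z] s2[of z] A0 by (auto simp: abs_mult intro!: mult_mono)
  have intas2: "integrable M (\<lambda>z. a z * (s z)\<^sup>2)"
    by (rule integrable_const_bound[of _ "A * T\<^sup>2"]) (use as2 in auto)
  define Q where "Q = (\<integral>z. a z * (s z)\<^sup>2 \<partial>M)"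
  have Q0: "0 \<le> Q" unfolding Q_def by (rule integral_nonneg_AE) (use a in auto)
  define h where "h = (\<lambda>k z. a z * (s z * eps z) ^ (k + 2) / fact (k + 2))"
  have [measurable]: "h k \<in> borel_measurable M" for k
    unfolding h_def by measurable
  have nh: "norm (h k z) = (a z * \<bar>s z\<bar> ^ (k + 2)) * \<bar>eps z\<bar> ^ (k + 2) / fact (k + 2)" for k z
    using a by (simp add: h_def abs_mult power_abs power_mult_distrib)
  \<comment> \<open>This bound on absolute terms serves twice: it justifies exchanging sum and
    integral, and it bounds the exchanged sum.\<close>
  have step: "integrable M (\<lambda>z. norm (h k z))"
    "(\<integral>z. norm (h k z) \<partial>M) \<le> \<sigma>\<^sup>2 * Q / 2 * (1 / 2) ^ k" for k
  proof -
    let ?w = "\<lambda>z. a z * \<bar>s z\<bar> ^ (k + 2)"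
    let ?c = "fact (k + 2) / 2 * \<sigma>\<^sup>2 * \<Gamma> ^ k :: real"
    have wle: "?w z \<le> A * T ^ (k + 2)" for z
      by (intro mult_mono power_mono a s) (use A0 in auto)
    \<comment> \<open>Two factors of \<open>s\<close> are kept as a square, so that the bound is
      proportional to \<open>Q\<close>; only the other k factors are replaced by
      \<open>T\<close>.\<close>
    have wle2: "?w z \<le> T ^ k * (a z * (s z)\<^sup>2)" for z
    proof -
      have "?w z = \<bar>s z\<bar> ^ k * (a z * (s z)\<^sup>2)" by (simp add: power_add power2_eq_square)
      also have "\<dots> \<le> T ^ k * (a z * (s z)\<^sup>2)"
        by (intro mult_right_mono power_mono s) (use a in auto)
      finally show ?thesis .
    qed
    have w0: "0 \<le> ?w z" for z using a by simp
    have [measurable]: "?w \<in> borel_measurable F" by measurable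
    have mom': "AE z in M. real_cond_exp M F (\<lambda>z. \<bar>eps z\<bar> ^ (k + 2)) z \<le> ?c"
      using mom[of "k + 2"] by simp
    note * = integral_mult_cond_exp_le[OF _ intk[of "k + 2"] w0 wle mom']
    have i: "integrable M (\<lambda>z. ?w z * \<bar>eps z\<bar> ^ (k + 2))" using *(1) by simp
    show "integrable M (\<lambda>z. norm (h k z))" unfolding nh using i by simp
    have "(\<integral>z. ?w z * \<bar>eps z\<bar> ^ (k + 2) \<partial>M) \<le> ?c * (\<integral>z. ?w z \<partial>M)" using *(2) by simp
    also have "\<dots> \<le> ?c * (\<integral>z. T ^ k * (a z * (s z)\<^sup>2) \<partial>M)"
    proof (intro mult_left_mono integral_mono wle2)
      show "integrable M ?w"
        by (rule integrable_const_bound[of _ "A * T ^ (k + 2)"]) (use w0 wle in auto)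
      show "0 \<le> ?c" using \<Gamma> by simp
    qed (use intas2 in auto)
    also have "\<dots> = fact (k + 2) * (\<sigma>\<^sup>2 * Q / 2 * (T * \<Gamma>) ^ k)"
      by (simp add: Q_def power_mult_distrib)
    also have "\<dots> \<le> fact (k + 2) * (\<sigma>\<^sup>2 * Q / 2 * (1 / 2) ^ k)"
      by (intro mult_left_mono power_mono T) (use \<Gamma> T0 Q0 in auto)
    finally have "(\<integral>z. ?w z * \<bar>eps z\<bar> ^ (k + 2) \<partial>M) \<le> fact (k + 2) * (\<sigma>\<^sup>2 * Q / 2 * (1 / 2) ^ k)" .
    then show "(\<integral>z. norm (h k z) \<partial>M) \<le> \<sigma>\<^sup>2 * Q / 2 * (1 / 2) ^ k"
      unfolding nh by (simp add: pos_divide_le_eq mult.commute del: fact_Suc add_2_eq_Suc')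
  qed
  \<comment> \<open>The sum 2 of the geometric series cancels the 1/2 of the moment
    condition.\<close>
  have geo: "(\<lambda>k. \<sigma>\<^sup>2 * Q / 2 * (1 / 2) ^ k) sums (\<sigma>\<^sup>2 * Q)"
    using sums_mult[OF geometric_sums[of "1 / 2 :: real"], of "\<sigma>\<^sup>2 * Q / 2"] by simp
  have inth: "integrable M (h k)" for k
    using step(1)[of k] by (subst (asm) integrable_norm_iff) auto
  have sumh: "summable (\<lambda>k. norm (h k z))" for z
  proof -
    have "summable (\<lambda>k. a z * (\<bar>s z * eps z\<bar> ^ (k + 2) / fact (k + 2)))"
      using exp_second_order_sums[THEN sums_summable] by (rule summable_mult)
    then show ?thesis
      using a by (simp add: h_def abs_mult power_abs power_mult_distrib)
  qed
  have sumI: "summable (\<lambda>k. \<integral>z. norm (h k z) \<partial>M)"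
    by (rule summable_comparison_test_ev[OF _ sums_summable[OF geo]]) (use step(2) in auto)
  have eq: "a z * exp (s z * eps z) = a z + (a z * s z) * eps z + (\<Sum>k. h k z)" for z
  proof -
    have "(\<Sum>k. h k z) = a z * (exp (s z * eps z) - 1 - s z * eps z)"
      using sums_unique[OF sums_mult[OF exp_second_order_sums[of "s z * eps z"], of "a z"]]
      by (simp add: h_def)
    then show ?thesis by (simp add: algebra_simps)
  qed
  have int_sum: "integrable M (\<lambda>z. \<Sum>k. h k z)"
    by (rule integrable_suminf[OF inth _ sumI]) (use sumh in auto)
  have aT: "\<bar>a z * s z\<bar> \<le> A * T" for z
    using a[of z] s[of z] A0 by (auto simp: abs_mult intro!: mult_mono)
  have [measurable]: "(\<lambda>z. a z * s z) \<in> borel_measurable F" by measurable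
  note int_lin = integral_mult_cond_mean_zero(1)[OF this int1 aT mean]
    and lin0 = integral_mult_cond_mean_zero(2)[OF this int1 aT mean]
  show "integrable M (\<lambda>z. a z * exp (s z * eps z))"
    unfolding eq using inta int_lin int_sum by auto
  have "(\<integral>z. a z * exp (s z * eps z) \<partial>M) = (\<integral>z. a z \<partial>M) + (\<integral>z. (\<Sum>k. h k z) \<partial>M)"
    unfolding eq using inta int_lin int_sum lin0 by simp
  also have "(\<integral>z. (\<Sum>k. h k z) \<partial>M) = (\<Sum>k. \<integral>z. h k z \<partial>M)"
    by (rule integral_suminf[OF inth _ sumI]) (use sumh in auto)
  also have "\<dots> \<le> \<sigma>\<^sup>2 * Q"
  proof (rule sums_le[OF _ summable_sums geo])
    show "summable (\<lambda>k. \<integral>z. h k z \<partial>M)"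
      by (rule summable_integral[OF inth _ sumI]) (use sumh in auto)
    show "(\<integral>z. h k z \<partial>M) \<le> \<sigma>\<^sup>2 * Q / 2 * (1 / 2) ^ k" for k
      using integral_norm_bound[of M "h k"] step(2)[of k] unfolding real_norm_def by linarith
  qed
  also have "(\<integral>z. a z \<partial>M) + \<sigma>\<^sup>2 * Q = (\<integral>z. a z * (1 + (s z)\<^sup>2 * \<sigma>\<^sup>2) \<partial>M)"
  proof -
    have "(\<integral>z. a z * (1 + (s z)\<^sup>2 * \<sigma>\<^sup>2) \<partial>M) = (\<integral>z. a z + \<sigma>\<^sup>2 * (a z * (s z)\<^sup>2) \<partial>M)"
      by (simp add: algebra_simps)
    then show ?thesis using inta intas2 by (simp add: Q_def)
  qed
  finally show "(\<integral>z. a z * exp (s z * eps z) \<partial>M) \<le> (\<integral>z. a z * (1 + (s z)\<^sup>2 * \<sigma>\<^sup>2) \<partial>M)"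
    by simp
qed

end

section \<open>Loss differences in bounded regression with Bernstein noise\<close>

lemma exp_le_quadratic:
  fixes x :: real
  assumes "\<bar>x\<bar> \<le> 1"
  shows "exp x \<le> 1 + x + x\<^sup>2"
proof (cases "0 \<le> x")
  case True
  then show ?thesis using exp_bound[of x] assms by simp
next
  case False
  then have x: "x \<le> 0" by simp
  have pos: "0 < 1 - x + x\<^sup>2 / 2" using x by (simp add: add_pos_nonneg)
  \<comment> \<open>For negative x the reciprocal is estimated instead: the Taylor polynomial below
    \<open>exp (- x)\<close>, multiplied by the claimed bound, is at least one.\<close>
  have "1 - x + x\<^sup>2 / 2 \<le> exp (- x)"
    using exp_lower_Taylor_quadratic[of "- x"] x by simp
  then have "exp x * (1 - x + x\<^sup>2 / 2) \<le> exp x * exp (- x)" by (intro mult_left_mono) auto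
  also have "\<dots> = 1" by (simp add: exp_minus)
  also have "\<dots> \<le> (1 + x + x\<^sup>2) * (1 - x + x\<^sup>2 / 2)"
  proof -
    have "(1 + x + x\<^sup>2) * (1 - x + x\<^sup>2 / 2) = 1 + x\<^sup>2 / 2 * (1 - x + x\<^sup>2)"
      by (simp add: field_simps power2_eq_square)
    moreover have "0 \<le> x\<^sup>2 / 2 * (1 - x + x\<^sup>2)" using x by simp
    ultimately show ?thesis by linarith
  qed
  finally show ?thesis using pos by (rule mult_right_le_imp_le)
qed

text \<open>For \<open>\<bar>\<tau>\<bar>\<close> up to the inverse of this scale, the second-order terms in the exponential moments
  of loss differences cost at most \<open>\<bar>\<tau>\<bar> / 3\<close> times the excess risk.\<close>

definition bernstein_scale :: "real \<Rightarrow> real \<Rightarrow> real \<Rightarrow> real" where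
  "bernstein_scale C \<sigma> \<Gamma> = 48 * C\<^sup>2 + 12 * \<sigma>\<^sup>2 + 8 * C * \<Gamma>"

text \<open>The second moment of the input stays outside this locale; it enters only when networks
  with nearby parameters are compared.\<close>

locale bernstein_regression = prob_space D
  for D :: "((nat \<Rightarrow> real) \<times> real) measure" +
  fixes p :: nat and f :: "(nat \<Rightarrow> real) \<Rightarrow> real" and C \<sigma> \<Gamma> :: real
  assumes C: "C \<ge> 1" and sigma: "\<sigma> > 0" and Gamma: "\<Gamma> > 0"
    and sets_D [measurable_cong]: "sets D = sets (input_space p \<Otimes>\<^sub>M borel)"
    and f_meas [measurable]: "f \<in> borel_measurable (input_space p)"
    and f_bound: "AE z in D. \<bar>f (fst z)\<bar> \<le> C"
    and noise_int: "integrable D (\<lambda>z. snd z - f (fst z))"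
    and noise_mean: "AE z in D. real_cond_exp D (vimage_algebra (space D) fst (input_space p))
                    (\<lambda>z. snd z - f (fst z)) z = 0"
    and noise_moments_int: "\<And>k. k \<ge> 2 \<Longrightarrow> integrable D (\<lambda>z. \<bar>snd z - f (fst z)\<bar> ^ k)"
    and noise_moments: "\<And>k. k \<ge> 2 \<Longrightarrow>
         AE z in D. real_cond_exp D (vimage_algebra (space D) fst (input_space p))
                       (\<lambda>z. \<bar>snd z - f (fst z)\<bar> ^ k) z
                     \<le> fact k / 2 * \<sigma>\<^sup>2 * \<Gamma> ^ (k - 2)"
begin

abbreviation "F \<equiv> vimage_algebra (space D) fst (input_space p)"

lemma fst_measurable_D: "fst \<in> measurable D (input_space p)"
  by (simp add: measurable_cong_sets[OF sets_D refl])

sublocale cond: finite_measure_subalgebra D F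
proof
  show "subalgebra D F"
    using sets_image_in_sets[OF refl fst_measurable_D] by (simp add: subalgebra_def)
qed

lemma measurable_fst_F: "g \<in> borel_measurable (input_space p) \<Longrightarrow> (\<lambda>z. g (fst z)) \<in> borel_measurable F"
  by (rule measurable_compose[OF measurable_vimage_algebra1])
     (use measurable_space[OF fst_measurable_D] in auto)

text \<open>The regression function is bounded by \<open>C\<close> only almost everywhere; clipping it makes the bound
  pointwise without changing any integral.\<close>

definition clipf :: "(nat \<Rightarrow> real) \<Rightarrow> real" where "clipf x = max (- C) (min (f x) C)"

lemma clipf_meas [measurable]: "clipf \<in> borel_measurable (input_space p)"
  unfolding clipf_def[abs_def] by measurable

lemma clipf_bound: "\<bar>clipf x\<bar> \<le> C"
  using C by (auto simp: clipf_def)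

lemma clipf_AE: "AE z in D. clipf (fst z) = f (fst z)"
  using f_bound by eventually_elim (auto simp: clipf_def)

context
  fixes \<phi> :: "(nat \<Rightarrow> real) \<Rightarrow> real"
  assumes phi_meas [measurable]: "\<phi> \<in> borel_measurable (input_space p)"
    and phi_bound: "\<And>x. \<bar>\<phi> x\<bar> \<le> C"
begin

definition diff_clipf :: "(nat \<Rightarrow> real) \<times> real \<Rightarrow> real" where
  "diff_clipf z = clipf (fst z) - \<phi> (fst z)"

lemma diff_clipf_F [measurable]: "diff_clipf \<in> borel_measurable F"
  unfolding diff_clipf_def[abs_def] by (rule measurable_fst_F) measurable

lemma diff_clipf_D [measurable]: "diff_clipf \<in> borel_measurable D"
  by (rule measurable_from_subalg[OF cond.subalg diff_clipf_F])

lemma diff_clipf_bound: "\<bar>diff_clipf z\<bar> \<le> 2 * C"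
  using clipf_bound[of "fst z"] phi_bound[of "fst z"] by (simp add: diff_clipf_def)

lemma diff_clipf_sq_bound: "(diff_clipf z)\<^sup>2 \<le> 4 * C\<^sup>2"
  using power_mono[OF diff_clipf_bound[of z] abs_ge_zero, of 2] by (simp add: power_mult_distrib)

lemma integrable_diff_clipf_sq: "integrable D (\<lambda>z. (diff_clipf z)\<^sup>2)"
  by (rule integrable_const_bound[of _ "4 * C\<^sup>2"]) (use diff_clipf_sq_bound in auto)

lemma integral_diff_clipf_sq: "(\<integral>z. (diff_clipf z)\<^sup>2 \<partial>D) = (\<integral>z. (f (fst z) - \<phi> (fst z))\<^sup>2 \<partial>D)"
  by (rule integral_cong_AE) (use clipf_AE in \<open>auto simp: diff_clipf_def\<close>)

text \<open>Pythagoras: \<open>diff_clipf\<close> depends on the input alone, so its product with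
  the noise integrates to zero.\<close>

lemma excess_risk_eq_clipf: "excess_risk D f \<phi> = (\<integral>z. (diff_clipf z)\<^sup>2 \<partial>D)"
proof -
  let ?e = "\<lambda>z. snd z - f (fst z)"
  have b: "\<bar>2 * diff_clipf z\<bar> \<le> 4 * C" for z using diff_clipf_bound[of z] by simp
  have "(\<lambda>z. 2 * diff_clipf z) \<in> borel_measurable F" by measurable
  note lin = cond.integral_mult_cond_mean_zero[OF this noise_int b noise_mean]
  have sq: "integrable D (\<lambda>z. (?e z)\<^sup>2)" using noise_moments_int[of 2] by simp
  have eq: "AE z in D. (snd z - \<phi> (fst z))\<^sup>2 = (?e z)\<^sup>2 + 2 * diff_clipf z * ?e z + (diff_clipf z)\<^sup>2"
    using clipf_AE by eventually_elim (simp add: diff_clipf_def power2_eq_square algebra_simps)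
  have m: "(\<lambda>z. (snd z - \<phi> (fst z))\<^sup>2) \<in> borel_measurable D" by measurable
  have "risk D \<phi> = (\<integral>z. (?e z)\<^sup>2 + 2 * diff_clipf z * ?e z + (diff_clipf z)\<^sup>2 \<partial>D)"
    unfolding risk_def by (rule integral_cong_AE) (use eq m in auto)
  also have "\<dots> = (\<integral>z. (?e z)\<^sup>2 \<partial>D) + (\<integral>z. (diff_clipf z)\<^sup>2 \<partial>D)"
    using sq lin integrable_diff_clipf_sq by simp
  finally show "excess_risk D f \<phi> = (\<integral>z. (diff_clipf z)\<^sup>2 \<partial>D)"
    by (simp add: excess_risk_def risk_def)
qed

lemma excess_risk_eq: "excess_risk D f \<phi> = (\<integral>z. (f (fst z) - \<phi> (fst z))\<^sup>2 \<partial>D)"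
  by (simp add: excess_risk_eq_clipf integral_diff_clipf_sq)

lemma excess_risk_nonneg: "0 \<le> excess_risk D f \<phi>"
  unfolding excess_risk_eq by (rule integral_nonneg_AE) simp

text \<open>With g the difference of the two functions and e the noise, the loss difference is g^2 +
  2 g e. Integrating out the noise leaves \<open>exp (u * g^2)\<close>. As g is bounded, the
  second-order term in g^2 is again a multiple of g^2, hence of the excess risk: the variance is
  controlled by the mean.\<close>

lemma loss_diff_mgf:
  assumes \<tau>: "\<bar>\<tau>\<bar> \<le> 1 / bernstein_scale C \<sigma> \<Gamma>"
  shows "(\<integral>\<^sup>+z. ennreal (exp (\<tau> * ((snd z - \<phi> (fst z))\<^sup>2 - (snd z - f (fst z))\<^sup>2))) \<partial>D)
         \<le> ennreal (exp ((\<tau> + \<bar>\<tau>\<bar> / 3) * excess_risk D f \<phi>))"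
proof -
  define g where "g = diff_clipf"
  \<comment> \<open>The correction \<open>4 * \<tau>^2 * \<sigma>^2\<close> is the variance term of
    the noise, whose multiplier is \<open>2 * \<tau> * g\<close>.\<close>
  define u where "u = \<tau> + 4 * \<tau>\<^sup>2 * \<sigma>\<^sup>2"
  let ?e = "\<lambda>z. snd z - f (fst z)"
  have [measurable]: "g \<in> borel_measurable F" "g \<in> borel_measurable D"
    unfolding g_def by auto
  have g: "\<bar>g z\<bar> \<le> 2 * C" "(g z)\<^sup>2 \<le> 4 * C\<^sup>2" for z
    unfolding g_def by (rule diff_clipf_bound diff_clipf_sq_bound)+
  have pos: "bernstein_scale C \<sigma> \<Gamma> > 0"
    using C Gamma by (auto simp: bernstein_scale_def intro!: add_pos_nonneg)
  have "\<bar>\<tau>\<bar> * bernstein_scale C \<sigma> \<Gamma> \<le> 1"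
    using \<tau> pos by (simp add: pos_le_divide_eq)
  \<comment> \<open>The scale is a sum because \<open>u_le\<close> needs its two error terms below
    1/3 jointly: a third of this inequality gives \<open>4 * \<bar>\<tau>\<bar> * \<sigma>^2 + 16 *
    \<bar>\<tau>\<bar> * C^2 \<le> 1 / 3\<close>. The last summand supplies the condition
    \<open>T\<close>.\<close>
  then have sum1: "48 * (\<bar>\<tau>\<bar> * C\<^sup>2) + 12 * (\<bar>\<tau>\<bar> * \<sigma>\<^sup>2) + 8 * (\<bar>\<tau>\<bar> * C * \<Gamma>) \<le> 1"
    by (simp add: bernstein_scale_def algebra_simps)
  have nn: "0 \<le> \<bar>\<tau>\<bar> * C\<^sup>2" "0 \<le> \<bar>\<tau>\<bar> * \<sigma>\<^sup>2" "0 \<le> \<bar>\<tau>\<bar> * C * \<Gamma>"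
    using C Gamma by auto
  have abs_u: "\<bar>u\<bar> \<le> 4 / 3 * \<bar>\<tau>\<bar>"
  proof -
    have "\<bar>u\<bar> \<le> \<bar>\<tau>\<bar> + \<bar>4 * \<tau>\<^sup>2 * \<sigma>\<^sup>2\<bar>" unfolding u_def by (rule abs_triangle_ineq)
    also have "\<bar>4 * \<tau>\<^sup>2 * \<sigma>\<^sup>2\<bar> = \<bar>\<tau>\<bar> * (4 * (\<bar>\<tau>\<bar> * \<sigma>\<^sup>2))"
      by (simp add: abs_mult power2_eq_square)
    also have "\<dots> \<le> \<bar>\<tau>\<bar> * (1 / 3)" by (rule mult_left_mono) (use sum1 nn in linarith)+
    finally show ?thesis by simp
  qed
  have u_le: "u + 4 * C\<^sup>2 * u\<^sup>2 \<le> \<tau> + \<bar>\<tau>\<bar> / 3"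
  proof -
    have "u\<^sup>2 \<le> (4 / 3 * \<bar>\<tau>\<bar>)\<^sup>2" using power_mono[OF abs_u abs_ge_zero, of 2] by simp
    then have "4 * C\<^sup>2 * u\<^sup>2 \<le> 4 * C\<^sup>2 * (4 / 3 * \<bar>\<tau>\<bar>)\<^sup>2" by (rule mult_left_mono) simp
    also have "\<dots> = \<bar>\<tau>\<bar> * (64 / 9 * (\<bar>\<tau>\<bar> * C\<^sup>2))"
      by (simp add: power2_eq_square)
    finally have "u + 4 * C\<^sup>2 * u\<^sup>2 \<le> \<tau> + \<bar>\<tau>\<bar> * (4 * (\<bar>\<tau>\<bar> * \<sigma>\<^sup>2) + 64 / 9 * (\<bar>\<tau>\<bar> * C\<^sup>2))"
      by (simp add: u_def power2_eq_square algebra_simps)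
    also have "\<dots> \<le> \<tau> + \<bar>\<tau>\<bar> * (1 / 3)"
      by (intro add_left_mono mult_left_mono) (use sum1 nn in linarith)+
    finally show ?thesis by simp
  qed
  have ug: "\<bar>u * (g z)\<^sup>2\<bar> \<le> 1" for z
  proof -
    have "\<bar>u * (g z)\<^sup>2\<bar> \<le> (4 / 3 * \<bar>\<tau>\<bar>) * (4 * C\<^sup>2)"
      unfolding abs_mult by (intro mult_mono abs_u) (use g in auto)
    also have "\<dots> = 16 / 3 * (\<bar>\<tau>\<bar> * C\<^sup>2)" by simp
    also have "\<dots> \<le> 1" using sum1 nn by linarith
    finally show ?thesis .
  qed
  let ?a = "\<lambda>z. exp (\<tau> * (g z)\<^sup>2)" and ?s = "\<lambda>z. 2 * \<tau> * g z"
  have a_le: "?a z \<le> exp (\<bar>\<tau>\<bar> * (4 * C\<^sup>2))" for z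
  proof -
    have "\<tau> * (g z)\<^sup>2 \<le> \<bar>\<tau>\<bar> * (4 * C\<^sup>2)" by (intro mult_mono g) auto
    then show ?thesis by simp
  qed
  have s_le: "\<bar>?s z\<bar> \<le> 4 * \<bar>\<tau>\<bar> * C" for z
    using mult_left_mono[OF g(1)[of z], of "2 * \<bar>\<tau>\<bar>"] by (simp add: abs_mult)
  have aF: "?a \<in> borel_measurable F" and sF: "?s \<in> borel_measurable F" by measurable
  have T: "4 * \<bar>\<tau>\<bar> * C * \<Gamma> \<le> 1 / 2"
  proof -
    have "4 * \<bar>\<tau>\<bar> * C * \<Gamma> = 4 * (\<bar>\<tau>\<bar> * C * \<Gamma>)" by simp
    then show ?thesis using sum1 nn by linarith
  qed
  note mgf = cond.integral_exp_mult_le_of_bernstein[OF aF sF exp_ge_zero a_le s_le T Gamma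
      noise_int noise_mean noise_moments_int noise_moments]
  have "(\<integral>\<^sup>+z. ennreal (exp (\<tau> * ((snd z - \<phi> (fst z))\<^sup>2 - (?e z)\<^sup>2))) \<partial>D)
      = (\<integral>\<^sup>+z. ennreal (?a z * exp (?s z * ?e z)) \<partial>D)"
  proof (rule nn_integral_cong_AE, use clipf_AE in eventually_elim)
    fix z :: "(nat \<Rightarrow> real) \<times> real" assume "clipf (fst z) = f (fst z)"
    then have "\<tau> * ((snd z - \<phi> (fst z))\<^sup>2 - (?e z)\<^sup>2) = \<tau> * (g z)\<^sup>2 + ?s z * ?e z"
      by (simp add: g_def diff_clipf_def power2_eq_square algebra_simps)
    then show "ennreal (exp (\<tau> * ((snd z - \<phi> (fst z))\<^sup>2 - (?e z)\<^sup>2)))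
        = ennreal (?a z * exp (?s z * ?e z))"
      by (simp add: exp_add)
  qed
  also have "\<dots> = ennreal (\<integral>z. ?a z * exp (?s z * ?e z) \<partial>D)"
    by (rule nn_integral_eq_integral[OF mgf(1)]) auto
  also have "\<dots> \<le> ennreal (exp ((\<tau> + \<bar>\<tau>\<bar> / 3) * excess_risk D f \<phi>))"
  proof (rule ennreal_leI)
    have int_g: "integrable D (\<lambda>z. (g z)\<^sup>2)" unfolding g_def by (rule integrable_diff_clipf_sq)
    have int_exp: "integrable D (\<lambda>z. exp (u * (g z)\<^sup>2))"
      by (rule integrable_const_bound[of _ "exp 1"]) (use abs_le_D1[OF ug] in auto)
    have le1: "?a z * (1 + (?s z)\<^sup>2 * \<sigma>\<^sup>2) \<le> exp (u * (g z)\<^sup>2)" for z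
    proof -
      have "?a z * (1 + (?s z)\<^sup>2 * \<sigma>\<^sup>2) \<le> ?a z * exp ((?s z)\<^sup>2 * \<sigma>\<^sup>2)"
        by (intro mult_left_mono exp_ge_add_one_self) auto
      also have "\<dots> = exp (u * (g z)\<^sup>2)"
        unfolding exp_add[symmetric] u_def by (simp add: power2_eq_square algebra_simps)
      finally show ?thesis .
    qed
    have "(\<integral>z. ?a z * exp (?s z * ?e z) \<partial>D) \<le> (\<integral>z. ?a z * (1 + (?s z)\<^sup>2 * \<sigma>\<^sup>2) \<partial>D)"
      by (rule mgf(2))
    also have "\<dots> \<le> (\<integral>z. exp (u * (g z)\<^sup>2) \<partial>D)"
    proof (rule integral_mono[OF _ int_exp le1])
      show "integrable D (\<lambda>z. ?a z * (1 + (?s z)\<^sup>2 * \<sigma>\<^sup>2))"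
        by (rule Bochner_Integration.integrable_bound[OF int_exp])
           (use le1 in \<open>auto simp: abs_mult\<close>)
    qed
    also have "\<dots> \<le> (\<integral>z. 1 + (u + 4 * C\<^sup>2 * u\<^sup>2) * (g z)\<^sup>2 \<partial>D)"
    proof (rule integral_mono[OF int_exp])
      fix z
      have "exp (u * (g z)\<^sup>2) \<le> 1 + u * (g z)\<^sup>2 + (u * (g z)\<^sup>2)\<^sup>2"
        by (rule exp_le_quadratic[OF ug])
      \<comment> \<open>Boundedness turns the fourth power of g into a second one, whose integral is
        the excess risk.\<close>
      also have "(u * (g z)\<^sup>2)\<^sup>2 = u\<^sup>2 * (g z)\<^sup>2 * (g z)\<^sup>2" by (simp add: power2_eq_square)
      also have "\<dots> \<le> u\<^sup>2 * (g z)\<^sup>2 * (4 * C\<^sup>2)" by (intro mult_left_mono g) auto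
      finally show "exp (u * (g z)\<^sup>2) \<le> 1 + (u + 4 * C\<^sup>2 * u\<^sup>2) * (g z)\<^sup>2"
        by (simp add: algebra_simps)
    qed (use int_g in auto)
    also have "\<dots> = 1 + (u + 4 * C\<^sup>2 * u\<^sup>2) * excess_risk D f \<phi>"
      using int_g by (simp add: excess_risk_eq_clipf g_def prob_space)
    also have "\<dots> \<le> 1 + (\<tau> + \<bar>\<tau>\<bar> / 3) * excess_risk D f \<phi>"
      by (intro add_left_mono mult_right_mono u_le excess_risk_nonneg)
    also have "\<dots> \<le> exp ((\<tau> + \<bar>\<tau>\<bar> / 3) * excess_risk D f \<phi>)" by (rule exp_ge_add_one_self)
    finally show "(\<integral>z. ?a z * exp (?s z * ?e z) \<partial>D) \<le> exp ((\<tau> + \<bar>\<tau>\<bar> / 3) * excess_risk D f \<phi>)" .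
  qed
  finally show ?thesis .
qed

end

end

section \<open>Tails of Gibbs posteriors\<close>

text \<open>From \<open>x\<^sup>2 \<le> x \<le> \<delta>\<^sup>2 a b\<close> and AM-GM.  This is what lets the two exponential moments, which are
  controlled only in mean and are not independent, be decoupled.\<close>

lemma ennreal_le_mean_of_le_product:
  fixes x a b :: ennreal
  assumes "x \<le> 1" and le: "x \<le> ennreal (\<delta>\<^sup>2) * a * b" and \<delta>: "\<delta> > 0"
  shows "x \<le> ennreal (\<delta> / 2) * (a + b)"
proof (cases "a = \<top> \<or> b = \<top>")
  case True
  then show ?thesis using \<delta> by (auto simp: ennreal_mult_top ennreal_mult_eq_top_iff top_unique)
next
  case False
  then obtain u v where uv: "a = ennreal u" "b = ennreal v" "0 \<le> u" "0 \<le> v"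
    by (metis ennreal_cases)
  obtain y where y: "x = ennreal y" "0 \<le> y" "y \<le> 1"
    using \<open>x \<le> 1\<close> by (cases x) (auto simp: top_unique)
  have "y \<le> \<delta>\<^sup>2 * u * v"
    using le uv y by (simp add: ennreal_mult[symmetric])
  moreover have "y\<^sup>2 \<le> y" using y by (simp add: power2_eq_square mult_left_le)
  moreover have "\<delta>\<^sup>2 * u * v \<le> (\<delta> / 2 * (u + v))\<^sup>2"
  proof -
    have "0 \<le> \<delta>\<^sup>2 * (u - v)\<^sup>2" by simp
    then show ?thesis by (simp add: power2_eq_square algebra_simps)
  qed
  ultimately have "y\<^sup>2 \<le> (\<delta> / 2 * (u + v))\<^sup>2" by linarith
  then have "y \<le> \<delta> / 2 * (u + v)"
    by (rule power2_le_imp_le) (use uv \<delta> in auto)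
  then show ?thesis
    using uv y \<delta> by (simp add: ennreal_mult[symmetric] ennreal_plus[symmetric] del: ennreal_plus)
qed

text \<open>Cauchy-Schwarz for \<open>sqrt w\<close> and its reciprocal on \<open>A\<close>. It
  bounds a partition function from below through the reciprocal weight, whose mean over the sample
  is accessible by Fubini.\<close>

lemma emeasure_sq_le_nn_integral_inverse:
  fixes w :: "'a \<Rightarrow> real"
  assumes [measurable]: "w \<in> borel_measurable M" "A \<in> sets M" and w: "\<And>x. 0 < w x"
  shows "(emeasure M A)\<^sup>2 \<le> (\<integral>\<^sup>+x. ennreal (w x) * indicator A x \<partial>M)
                          * (\<integral>\<^sup>+x. ennreal (1 / w x) * indicator A x \<partial>M)"
proof -
  let ?f = "\<lambda>x. ennreal (sqrt (w x)) * indicator A x"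
  let ?g = "\<lambda>x. ennreal (1 / sqrt (w x)) * indicator A x"
  have sq: "(ennreal (sqrt (w x)))\<^sup>2 = ennreal (w x)" "(ennreal (1 / sqrt (w x)))\<^sup>2 = ennreal (1 / w x)" for x
    using less_imp_le[OF w[of x]] by (simp_all add: ennreal_power power_divide)
  have fg: "?f x * ?g x = indicator A x" for x
    using w[of x] by (auto simp: indicator_def ennreal_mult[symmetric])
  have "(\<integral>\<^sup>+x. ?f x * ?g x \<partial>M)\<^sup>2 \<le> (\<integral>\<^sup>+x. (?f x)\<^sup>2 \<partial>M) * (\<integral>\<^sup>+x. (?g x)\<^sup>2 \<partial>M)"
    by (rule Cauchy_Schwarz_nn_integral) measurable
  moreover have "(?f x)\<^sup>2 = ennreal (w x) * indicator A x"
    "(?g x)\<^sup>2 = ennreal (1 / w x) * indicator A x" for x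
    by (auto simp: power_mult_distrib sq indicator_def)
  ultimately show ?thesis by (simp add: fg)
qed

text \<open>Here \<open>t\<close> is the inverse temperature per observation, so that \<lambda> = t
  n, and \<open>e\<close> stands for the excess risk. The coefficients \<alpha> and \<gamma> record
  how much of it survives in the two exponential moments; for regression they are 2/3 and
  4/3.\<close>

locale gibbs_setup = data: prob_space D + prior: prob_space Pr
  for D :: "'z measure" and Pr :: "'a measure" +
  fixes loss :: "'a \<Rightarrow> 'z \<Rightarrow> real" and loss0 :: "'z \<Rightarrow> real" and e :: "'a \<Rightarrow> real"
    and t \<alpha> \<gamma> :: real and n :: nat
  assumes loss_meas [measurable]: "(\<lambda>(\<theta>, z). loss \<theta> z) \<in> borel_measurable (Pr \<Otimes>\<^sub>M D)"
    and loss0_meas [measurable]: "loss0 \<in> borel_measurable D"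
    and e_meas [measurable]: "e \<in> borel_measurable Pr"
    and loss_nonneg: "\<And>\<theta> z. 0 \<le> loss \<theta> z"
    and t: "0 < t" and \<alpha>: "0 \<le> \<alpha>" and \<gamma>: "0 \<le> \<gamma>"
    and mgf_neg: "\<And>\<theta>. \<theta> \<in> space Pr \<Longrightarrow>
       (\<integral>\<^sup>+z. ennreal (exp (- t * (loss \<theta> z - loss0 z))) \<partial>D) \<le> ennreal (exp (- \<alpha> * t * e \<theta>))"
    and mgf_pos: "\<And>\<theta>. \<theta> \<in> space Pr \<Longrightarrow>
       (\<integral>\<^sup>+z. ennreal (exp (t * (loss \<theta> z - loss0 z))) \<partial>D) \<le> ennreal (exp (\<gamma> * t * e \<theta>))"
begin

abbreviation "Dn \<equiv> PiM {..<n} (\<lambda>_. D)"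

sublocale prod: product_prob_space "\<lambda>_. D" "{..<n}" ..
sublocale PD: pair_sigma_finite Pr Dn ..

section \<open>Posterior weights relative to a reference loss\<close>

definition weight :: "(nat \<Rightarrow> 'z) \<Rightarrow> 'a \<Rightarrow> real" where
  "weight S \<theta> = exp (- t * (\<Sum>i<n. loss \<theta> (S i)))"

lemma loss_meas_Dn [measurable]:
  "i < n \<Longrightarrow> (\<lambda>(\<theta>, S). loss \<theta> (S i)) \<in> borel_measurable (Pr \<Otimes>\<^sub>M Dn)"
proof -
  assume "i < n"
  then have "(\<lambda>x. snd x i) \<in> measurable (Pr \<Otimes>\<^sub>M Dn) D"
    by (intro measurable_compose[OF measurable_snd measurable_component_singleton]) simp
  then have "(\<lambda>x. (fst x, snd x i)) \<in> measurable (Pr \<Otimes>\<^sub>M Dn) (Pr \<Otimes>\<^sub>M D)"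
    by measurable
  from measurable_compose[OF this loss_meas] show ?thesis by (simp add: case_prod_beta')
qed

lemma weight_meas [measurable]: "(\<lambda>(\<theta>, S). weight S \<theta>) \<in> borel_measurable (Pr \<Otimes>\<^sub>M Dn)"
proof -
  have "(\<lambda>x. \<Sum>i<n. loss (fst x) (snd x i)) \<in> borel_measurable (Pr \<Otimes>\<^sub>M Dn)"
    by (rule borel_measurable_sum) (use loss_meas_Dn in \<open>auto simp: case_prod_beta'\<close>)
  then show ?thesis by (simp add: weight_def case_prod_beta')
qed

lemma weight_meas_slice [measurable]: "S \<in> space Dn \<Longrightarrow> weight S \<in> borel_measurable Pr"
  using measurable_compose[OF measurable_Pair2' weight_meas] by simp

lemma weight_pos: "0 < weight S \<theta>" by (simp add: weight_def)

lemma weight_le_1: "weight S \<theta> \<le> 1"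
  using t by (simp add: weight_def sum_nonneg loss_nonneg)

text \<open>Recenters the losses at \<open>loss0\<close>. Being independent of the parameter, it
  cancels from posterior ratios; in the tail bound it is the factor \<open>c\<close>.\<close>

definition loss0_weight :: "(nat \<Rightarrow> 'z) \<Rightarrow> real" where
  "loss0_weight S = exp (t * (\<Sum>i<n. loss0 (S i)))"

lemma loss0_meas_Dn [measurable]: "i < n \<Longrightarrow> (\<lambda>S. loss0 (S i)) \<in> borel_measurable Dn"
  by (rule measurable_compose[OF measurable_component_singleton[of i "{..<n}" "\<lambda>_. D"] loss0_meas]) simp

lemma loss0_weight_meas [measurable]: "loss0_weight \<in> borel_measurable Dn"
proof -
  have "(\<lambda>S. \<Sum>i<n. loss0 (S i)) \<in> borel_measurable Dn"
    by (rule borel_measurable_sum) (use loss0_meas_Dn in auto)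
  then show ?thesis unfolding loss0_weight_def[abs_def] by measurable
qed

lemma loss0_weight_pos: "0 < loss0_weight S" by (simp add: loss0_weight_def)

text \<open>Independence: the exponential of a sum over observations factorises under the product
  measure.\<close>

lemma nn_integral_Dn_exp_sum_le:
  assumes \<theta>: "\<theta> \<in> space Pr"
    and le: "(\<integral>\<^sup>+z. ennreal (exp (u * (loss \<theta> z - loss0 z))) \<partial>D) \<le> ennreal (exp v)"
  shows "(\<integral>\<^sup>+S. ennreal (exp (u * (\<Sum>i<n. loss \<theta> (S i) - loss0 (S i)))) \<partial>Dn) \<le> ennreal (exp (real n * v))"
proof -
  have [measurable]: "loss \<theta> \<in> borel_measurable D"
    using measurable_compose[OF measurable_Pair1'[OF \<theta>] loss_meas] by simp
  have "(\<integral>\<^sup>+S. ennreal (exp (u * (\<Sum>i<n. loss \<theta> (S i) - loss0 (S i)))) \<partial>Dn)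
      = (\<integral>\<^sup>+S. (\<Prod>i<n. ennreal (exp (u * (loss \<theta> (S i) - loss0 (S i))))) \<partial>Dn)"
    by (simp add: prod_ennreal exp_sum sum_distrib_left)
  also have "\<dots> = (\<Prod>i<n. \<integral>\<^sup>+z. ennreal (exp (u * (loss \<theta> z - loss0 z))) \<partial>D)"
    by (rule prod.product_nn_integral_prod) auto
  also have "\<dots> \<le> (\<Prod>i<n. ennreal (exp v))"
    by (rule prod_mono_ennreal) (rule le)
  also have "\<dots> = ennreal (exp (real n * v))"
    by (simp add: ennreal_power exp_of_nat_mult)
  finally show ?thesis .
qed

lemma partition_le_1: "(\<integral>\<^sup>+\<theta>. ennreal (weight S \<theta>) \<partial>Pr) \<le> 1"
proof -
  have "(\<integral>\<^sup>+\<theta>. ennreal (weight S \<theta>) \<partial>Pr) \<le> (\<integral>\<^sup>+\<theta>. 1 \<partial>Pr)"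
    by (intro nn_integral_mono) (use weight_le_1 in \<open>simp add: ennreal_le_1\<close>)
  then show ?thesis by (simp add: prior.emeasure_space_1)
qed

text \<open>A strictly positive weight cannot vanish almost everywhere under a probability measure.
  Together with \<open>partition_le_1\<close> this permits cancelling the partition function in
  \<open>ennreal\<close>, where cancellation fails at zero and at infinity.\<close>

lemma partition_pos:
  assumes "S \<in> space Dn"
  shows "0 < (\<integral>\<^sup>+\<theta>. ennreal (weight S \<theta>) \<partial>Pr)"
proof -
  note [measurable] = weight_meas_slice[OF assms]
  have "(\<integral>\<^sup>+\<theta>. ennreal (weight S \<theta>) \<partial>Pr) \<noteq> 0"
  proof
    assume "(\<integral>\<^sup>+\<theta>. ennreal (weight S \<theta>) \<partial>Pr) = 0"
    then have "AE \<theta> in Pr. ennreal (weight S \<theta>) = 0"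
      by (subst (asm) nn_integral_0_iff_AE) auto
    then have "AE \<theta> in Pr. False"
    proof eventually_elim
      fix \<theta> assume "ennreal (weight S \<theta>) = 0"
      then have "weight S \<theta> \<le> 0" by (simp add: ennreal_eq_0_iff)
      then show False using weight_pos[of S \<theta>] by linarith
    qed
    then show False by simp
  qed
  then show ?thesis by (simp add: zero_less_iff_neq_zero)
qed

text \<open>The tilt by \<open>exp (\<alpha> * t * real n * e \<theta>)\<close> is exactly what
  \<open>mgf_neg\<close> compensates for n observations, so the mean over the sample is at most
  one.\<close>

definition neg_moment :: "(nat \<Rightarrow> 'z) \<Rightarrow> ennreal" where
  "neg_moment S = (\<integral>\<^sup>+\<theta>. ennreal (exp (\<alpha> * t * real n * e \<theta>) * (weight S \<theta> * loss0_weight S)) \<partial>Pr)"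

text \<open>Counterpart for reciprocal weights, compensated by \<open>mgf_pos\<close>. The
  restriction to \<open>A\<close> makes its mean at most the mass of \<open>A\<close>.\<close>

definition pos_moment :: "'a set \<Rightarrow> (nat \<Rightarrow> 'z) \<Rightarrow> ennreal" where
  "pos_moment A S = (\<integral>\<^sup>+\<theta>. ennreal (exp (- \<gamma> * t * real n * e \<theta>) * (1 / (weight S \<theta> * loss0_weight S)))
      * indicator A \<theta> \<partial>Pr)"

lemma weight_mult_loss0_weight:
  "weight S \<theta> * loss0_weight S = exp (- t * (\<Sum>i<n. loss \<theta> (S i) - loss0 (S i)))"
  "1 / (weight S \<theta> * loss0_weight S) = exp (t * (\<Sum>i<n. loss \<theta> (S i) - loss0 (S i)))"
  by (simp_all add: weight_def loss0_weight_def exp_add[symmetric] sum_subtractf algebra_simps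
        exp_minus[symmetric] divide_inverse del: exp_minus)

lemma neg_moment_meas [measurable]: "neg_moment \<in> borel_measurable Dn"
proof -
  have "(\<lambda>(S, \<theta>). weight S \<theta>) \<in> borel_measurable (Dn \<Otimes>\<^sub>M Pr)"
    using measurable_pair_swap[OF weight_meas] by (simp add: case_prod_beta')
  note [measurable] = this
  show ?thesis unfolding neg_moment_def[abs_def] by measurable
qed

lemma pos_moment_meas [measurable]:
  assumes [measurable]: "A \<in> sets Pr"
  shows "pos_moment A \<in> borel_measurable Dn"
proof -
  have "(\<lambda>(S, \<theta>). weight S \<theta>) \<in> borel_measurable (Dn \<Otimes>\<^sub>M Pr)"
    using measurable_pair_swap[OF weight_meas] by (simp add: case_prod_beta')
  note [measurable] = this
  show ?thesis unfolding pos_moment_def[abs_def] by measurable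
qed

text \<open>After Fubini the tilt cancels the n-th power of the moment bound separately for each
  parameter; the integral over the prior is then one.\<close>

lemma neg_moment_le: "(\<integral>\<^sup>+S. neg_moment S \<partial>Dn) \<le> 1"
proof -
  have "(\<integral>\<^sup>+S. neg_moment S \<partial>Dn)
      = (\<integral>\<^sup>+\<theta>. (\<integral>\<^sup>+S. ennreal (exp (\<alpha> * t * real n * e \<theta>) * (weight S \<theta> * loss0_weight S)) \<partial>Dn) \<partial>Pr)"
    unfolding neg_moment_def by (rule PD.Fubini') measurable
  also have "\<dots> \<le> (\<integral>\<^sup>+\<theta>. 1 \<partial>Pr)"
  proof (rule nn_integral_mono)
    fix \<theta> assume \<theta> [measurable]: "\<theta> \<in> space Pr"
    have m [measurable]: "(\<lambda>S. weight S \<theta>) \<in> borel_measurable Dn"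
      using measurable_compose[OF measurable_Pair1'[OF \<theta>] weight_meas] by simp
    have "(\<integral>\<^sup>+S. ennreal (exp (\<alpha> * t * real n * e \<theta>) * (weight S \<theta> * loss0_weight S)) \<partial>Dn)
       = ennreal (exp (\<alpha> * t * real n * e \<theta>)) * (\<integral>\<^sup>+S. ennreal (weight S \<theta> * loss0_weight S) \<partial>Dn)"
      by (subst nn_integral_cmult[symmetric]) (auto simp: ennreal_mult')
    also have "\<dots> \<le> ennreal (exp (\<alpha> * t * real n * e \<theta>)) * ennreal (exp (real n * (- \<alpha> * t * e \<theta>)))"
      unfolding weight_mult_loss0_weight
      by (intro mult_left_mono nn_integral_Dn_exp_sum_le \<theta> mgf_neg) auto
    also have "\<dots> = 1"
      by (simp add: ennreal_mult[symmetric] exp_add[symmetric] algebra_simps)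
    finally show "(\<integral>\<^sup>+S. ennreal (exp (\<alpha> * t * real n * e \<theta>) * (weight S \<theta> * loss0_weight S)) \<partial>Dn) \<le> 1" .
  qed
  finally show ?thesis by (simp add: prior.emeasure_space_1)
qed

lemma pos_moment_le:
  assumes A [measurable]: "A \<in> sets Pr"
  shows "(\<integral>\<^sup>+S. pos_moment A S \<partial>Dn) \<le> emeasure Pr A"
proof -
  have "(\<integral>\<^sup>+S. pos_moment A S \<partial>Dn)
      = (\<integral>\<^sup>+\<theta>. (\<integral>\<^sup>+S. ennreal (exp (- \<gamma> * t * real n * e \<theta>) * (1 / (weight S \<theta> * loss0_weight S)))
            * indicator A \<theta> \<partial>Dn) \<partial>Pr)"
    unfolding pos_moment_def by (rule PD.Fubini') measurable
  also have "\<dots> \<le> (\<integral>\<^sup>+\<theta>. indicator A \<theta> \<partial>Pr)"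
  proof (rule nn_integral_mono)
    fix \<theta> assume \<theta> [measurable]: "\<theta> \<in> space Pr"
    have m [measurable]: "(\<lambda>S. weight S \<theta>) \<in> borel_measurable Dn"
      using measurable_compose[OF measurable_Pair1'[OF \<theta>] weight_meas] by simp
    have "(\<integral>\<^sup>+S. ennreal (exp (- \<gamma> * t * real n * e \<theta>) * (1 / (weight S \<theta> * loss0_weight S)))
            * indicator A \<theta> \<partial>Dn)
       = indicator A \<theta> * (ennreal (exp (- \<gamma> * t * real n * e \<theta>)) * (\<integral>\<^sup>+S. ennreal (1 / (weight S \<theta> * loss0_weight S)) \<partial>Dn))"
      by (subst nn_integral_cmult[symmetric], measurable, subst nn_integral_cmult[symmetric], measurable)
         (simp only: ennreal_mult'[OF exp_ge_zero] mult_ac)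
    also have "\<dots> \<le> indicator A \<theta> * (ennreal (exp (- \<gamma> * t * real n * e \<theta>)) * ennreal (exp (real n * (\<gamma> * t * e \<theta>))))"
      unfolding weight_mult_loss0_weight(2)
      by (intro mult_left_mono nn_integral_Dn_exp_sum_le \<theta> mgf_pos) auto
    also have "\<dots> = indicator A \<theta>"
      by (simp add: ennreal_mult[symmetric] exp_add[symmetric] algebra_simps)
    finally show "(\<integral>\<^sup>+S. ennreal (exp (- \<gamma> * t * real n * e \<theta>) * (1 / (weight S \<theta> * loss0_weight S)))
            * indicator A \<theta> \<partial>Dn) \<le> indicator A \<theta>" .
  qed
  finally show ?thesis by simp
qed

text \<open>The term \<open>2 * ln (1 / \<delta>)\<close> buys a factor \<delta>^2 in a bound by a
  product of two moments, of which the decoupling by AM-GM retains one power. The reference loss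
  cancels, so its own fluctuations never have to be controlled.\<close>

lemma gibbs_tail_bound:
  assumes A [measurable]: "A \<in> sets Pr" and a: "0 < a" "ennreal a \<le> emeasure Pr A"
    and s: "\<And>\<theta>. \<theta> \<in> A \<Longrightarrow> e \<theta> \<le> s"
    and \<delta>: "0 < \<delta>"
    and b: "t * real n * (\<alpha> * b - \<gamma> * s) \<ge> ln (1 / a) + 2 * ln (1 / \<delta>)"
  shows "(\<integral>\<^sup>+S. (\<integral>\<^sup>+\<theta>. ennreal (weight S \<theta>) * indicator {\<theta> \<in> space Pr. b < e \<theta>} \<theta> \<partial>Pr)
              / (\<integral>\<^sup>+\<theta>. ennreal (weight S \<theta>) \<partial>Pr) \<partial>Dn) \<le> ennreal \<delta>"
proof -
  \<comment> \<open>The exact mass of \<open>A\<close> replaces its lower bound \<open>a\<close>, so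
    that \<open>pos_moment A\<close> divided by it has mean at most one.\<close>
  define a' where "a' = measure Pr A"
  have a': "emeasure Pr A = ennreal a'" "0 < a'" "a \<le> a'"
    using a by (auto simp: a'_def prior.emeasure_eq_measure ennreal_le_iff)
  let ?G = "{\<theta> \<in> space Pr. b < e \<theta>}"
  have G [measurable]: "?G \<in> sets Pr" by measurable
  have pt: "(\<integral>\<^sup>+\<theta>. ennreal (weight S \<theta>) * indicator ?G \<theta> \<partial>Pr) / (\<integral>\<^sup>+\<theta>. ennreal (weight S \<theta>) \<partial>Pr)
      \<le> ennreal (\<delta> / 2) * (neg_moment S + ennreal (1 / a') * pos_moment A S)"
    if S: "S \<in> space Dn" for S
  proof -
    note [measurable] = weight_meas_slice[OF S]
    define J where "J = (\<integral>\<^sup>+\<theta>. ennreal (weight S \<theta>) * indicator ?G \<theta> \<partial>Pr)"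
    define Z where "Z = (\<integral>\<^sup>+\<theta>. ennreal (weight S \<theta>) \<partial>Pr)"
    define V where "V = (\<integral>\<^sup>+\<theta>. ennreal (1 / weight S \<theta>) * indicator A \<theta> \<partial>Pr)"
    define c where "c = loss0_weight S"
    have c: "0 < c" unfolding c_def by (rule loss0_weight_pos)
    have JZ: "J \<le> Z" unfolding J_def Z_def by (intro nn_integral_mono) (auto simp: indicator_def)
    have Z1: "Z \<le> 1" unfolding Z_def by (rule partition_le_1)
    have Z0: "0 < Z" unfolding Z_def by (rule partition_pos[OF S])
    \<comment> \<open>In effect 1/Z is at most V / a'^2: a lower bound on the normalising constant
      becomes an upper bound by a quantity with controlled mean.\<close>
    have CS: "ennreal (a'\<^sup>2) \<le> Z * V"
    proof -
      have "ennreal (a'\<^sup>2) = (emeasure Pr A)\<^sup>2" using a' by (simp add: ennreal_power)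
      also have "\<dots> \<le> (\<integral>\<^sup>+x. ennreal (weight S x) * indicator A x \<partial>Pr) * V"
        unfolding V_def by (rule emeasure_sq_le_nn_integral_inverse) (use weight_pos in auto)
      also have "\<dots> \<le> Z * V"
        unfolding Z_def by (intro mult_right_mono nn_integral_mono) (auto simp: indicator_def)
      finally show ?thesis .
    qed
    \<comment> \<open>As in a Chernoff bound, on the event b < e the tilt in
      \<open>neg_moment\<close> exceeds its value at b.\<close>
    have J_le: "J \<le> ennreal (exp (- (\<alpha> * t * real n * b)) / c) * neg_moment S"
    proof -
      have "J \<le> (\<integral>\<^sup>+\<theta>. ennreal (exp (- (\<alpha> * t * real n * b)) / c) *
          ennreal (exp (\<alpha> * t * real n * e \<theta>) * (weight S \<theta> * loss0_weight S)) \<partial>Pr)"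
        unfolding J_def
      proof (rule nn_integral_mono)
        fix \<theta> assume "\<theta> \<in> space Pr"
        have "weight S \<theta> \<le> exp (- (\<alpha> * t * real n * b)) / c * (exp (\<alpha> * t * real n * e \<theta>) * (weight S \<theta> * c))"
          if "b < e \<theta>"
        proof -
          have "\<alpha> * t * real n * b \<le> \<alpha> * t * real n * e \<theta>"
            using that t \<alpha> by (intro mult_left_mono) auto
          then have "1 \<le> exp (- (\<alpha> * t * real n * b) + \<alpha> * t * real n * e \<theta>)" by simp
          then have "weight S \<theta> * 1 \<le> weight S \<theta> * exp (- (\<alpha> * t * real n * b) + \<alpha> * t * real n * e \<theta>)"
            by (intro mult_left_mono) (use weight_pos less_imp_le in auto)
          then show ?thesis using c by (simp only: exp_add) (simp add: mult_ac)
        qed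
        then show "ennreal (weight S \<theta>) * indicator ?G \<theta> \<le> ennreal (exp (- (\<alpha> * t * real n * b)) / c) *
          ennreal (exp (\<alpha> * t * real n * e \<theta>) * (weight S \<theta> * loss0_weight S))"
          using c by (auto simp: indicator_def c_def ennreal_mult[symmetric] weight_pos less_imp_le intro!: ennreal_leI)
      qed
      also have "\<dots> = ennreal (exp (- (\<alpha> * t * real n * b)) / c) * neg_moment S"
        unfolding neg_moment_def by (rule nn_integral_cmult) measurable
      finally show ?thesis .
    qed
    \<comment> \<open>On \<open>A\<close> the tilt in \<open>pos_moment\<close> costs at most its
      value at \<open>s\<close>. The factor \<open>c\<close> meets the \<open>1 / c\<close> of
      \<open>J_le\<close> and disappears.\<close>
    have V_le: "V \<le> ennreal (exp (\<gamma> * t * real n * s) * c) * pos_moment A S"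
    proof -
      have "V \<le> (\<integral>\<^sup>+\<theta>. ennreal (exp (\<gamma> * t * real n * s) * c) *
          (ennreal (exp (- \<gamma> * t * real n * e \<theta>) * (1 / (weight S \<theta> * loss0_weight S))) * indicator A \<theta>) \<partial>Pr)"
        unfolding V_def
      proof (rule nn_integral_mono)
        fix \<theta> assume "\<theta> \<in> space Pr"
        have "1 / weight S \<theta> \<le> exp (\<gamma> * t * real n * s) * c * (exp (- \<gamma> * t * real n * e \<theta>) * (1 / (weight S \<theta> * c)))"
          if "\<theta> \<in> A"
        proof -
          have "\<gamma> * t * real n * e \<theta> \<le> \<gamma> * t * real n * s"
            using s[OF that] t \<gamma> by (intro mult_left_mono) auto
          then have "1 \<le> exp (\<gamma> * t * real n * s + - \<gamma> * t * real n * e \<theta>)" by simp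
          then have "1 / weight S \<theta> * 1 \<le> 1 / weight S \<theta> * exp (\<gamma> * t * real n * s + - \<gamma> * t * real n * e \<theta>)"
            by (intro mult_left_mono) (use weight_pos less_imp_le in auto)
          then show ?thesis using c by (simp only: exp_add) (simp add: mult_ac)
        qed
        then show "ennreal (1 / weight S \<theta>) * indicator A \<theta> \<le> ennreal (exp (\<gamma> * t * real n * s) * c) *
          (ennreal (exp (- \<gamma> * t * real n * e \<theta>) * (1 / (weight S \<theta> * loss0_weight S))) * indicator A \<theta>)"
          using c by (auto simp: indicator_def c_def ennreal_mult[symmetric] weight_pos less_imp_le intro!: ennreal_leI)
      qed
      also have "\<dots> = ennreal (exp (\<gamma> * t * real n * s) * c) * pos_moment A S"
        unfolding pos_moment_def by (rule nn_integral_cmult) measurable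
      finally show ?thesis .
    qed
    \<comment> \<open>The deterministic factor that remains once \<open>c\<close> has cancelled. The
      hypothesis on \<open>b\<close> says precisely that it is at most
      \<open>a * \<delta>^2\<close>.\<close>
    define q where "q = exp (\<gamma> * t * real n * s - \<alpha> * t * real n * b)"
    have q: "q \<le> a' * \<delta>\<^sup>2"
    proof -
      have "\<gamma> * t * real n * s - \<alpha> * t * real n * b \<le> ln (a * \<delta>\<^sup>2)"
        using b a \<delta> by (simp add: ln_mult ln_div ln_realpow algebra_simps)
      then have "q \<le> exp (ln (a * \<delta>\<^sup>2))" unfolding q_def by simp
      also have "\<dots> = a * \<delta>\<^sup>2" using a \<delta> by simp
      also have "\<dots> \<le> a' * \<delta>\<^sup>2" using a' by (intro mult_right_mono) auto
      finally show ?thesis .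
    qed
    \<comment> \<open>Products are kept as long as possible because the moments may be infinite;
      only the positive finite quantities \<open>a'\<close> and \<open>Z\<close> are divided
      out.\<close>
    have "J * ennreal (a'\<^sup>2) \<le> J * (Z * V)" by (intro mult_left_mono CS) auto
    also have "\<dots> \<le> ennreal (exp (- (\<alpha> * t * real n * b)) / c) * neg_moment S *
        (Z * (ennreal (exp (\<gamma> * t * real n * s) * c) * pos_moment A S))"
      by (intro mult_mono J_le V_le mult_left_mono) auto
    also have "\<dots> = ennreal (exp (- (\<alpha> * t * real n * b)) / c) * ennreal (exp (\<gamma> * t * real n * s) * c) *
        (Z * neg_moment S * pos_moment A S)"
      by (simp add: mult_ac)
    also have "ennreal (exp (- (\<alpha> * t * real n * b)) / c) * ennreal (exp (\<gamma> * t * real n * s) * c) = ennreal q"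
      using c by (simp add: ennreal_mult[symmetric] q_def exp_diff exp_minus field_simps)
    also have "ennreal q * (Z * neg_moment S * pos_moment A S) \<le>
        ennreal (a' * \<delta>\<^sup>2) * (Z * neg_moment S * pos_moment A S)"
      by (intro mult_right_mono ennreal_leI q) auto
    finally have main: "J * ennreal (a'\<^sup>2) \<le> ennreal (a' * \<delta>\<^sup>2) * (Z * neg_moment S * pos_moment A S)" .
    have "J / Z \<le> ennreal (\<delta>\<^sup>2) * neg_moment S * (ennreal (1 / a') * pos_moment A S)"
    proof -
      have "J = J * ennreal (a'\<^sup>2) * ennreal (1 / a'\<^sup>2)"
        using a' by (simp add: mult.assoc ennreal_mult[symmetric])
      also have "\<dots> \<le> ennreal (a' * \<delta>\<^sup>2) * (Z * neg_moment S * pos_moment A S) * ennreal (1 / a'\<^sup>2)"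
        by (intro mult_right_mono main) auto
      also have "\<dots> = (ennreal (a' * \<delta>\<^sup>2) * ennreal (1 / a'\<^sup>2)) * (Z * neg_moment S * pos_moment A S)"
        by (simp add: mult_ac)
      also have "ennreal (a' * \<delta>\<^sup>2) * ennreal (1 / a'\<^sup>2) = ennreal (\<delta>\<^sup>2) * ennreal (1 / a')"
        using a' by (simp add: ennreal_mult[symmetric] power2_eq_square)
      finally have "J \<le> ennreal (\<delta>\<^sup>2) * neg_moment S * (ennreal (1 / a') * pos_moment A S) * Z"
        by (simp add: mult_ac)
      then have "J / Z \<le> ennreal (\<delta>\<^sup>2) * neg_moment S * (ennreal (1 / a') * pos_moment A S) * Z / Z"
        by (rule divide_right_mono_ennreal)
      also have "\<dots> = ennreal (\<delta>\<^sup>2) * neg_moment S * (ennreal (1 / a') * pos_moment A S)"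
        using Z0 le_less_trans[OF Z1 ennreal_one_less_top] by (intro mult_divide_eq_ennreal) auto
      finally show ?thesis .
    qed
    moreover have "J / Z \<le> 1"
      using divide_right_mono_ennreal[OF JZ, of Z] Z0 Z1
      le_less_trans[OF Z1 ennreal_one_less_top]
      by (subst (asm) ennreal_divide_self) auto
    ultimately show ?thesis
      unfolding J_def Z_def using \<delta> by (intro ennreal_le_mean_of_le_product) auto
  qed
  have "(\<integral>\<^sup>+S. (\<integral>\<^sup>+\<theta>. ennreal (weight S \<theta>) * indicator ?G \<theta> \<partial>Pr)
              / (\<integral>\<^sup>+\<theta>. ennreal (weight S \<theta>) \<partial>Pr) \<partial>Dn)
     \<le> (\<integral>\<^sup>+S. ennreal (\<delta> / 2) * (neg_moment S + ennreal (1 / a') * pos_moment A S) \<partial>Dn)"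
    by (rule nn_integral_mono) (rule pt)
  also have "\<dots> = ennreal (\<delta> / 2) * ((\<integral>\<^sup>+S. neg_moment S \<partial>Dn) + ennreal (1 / a') * (\<integral>\<^sup>+S. pos_moment A S \<partial>Dn))"
    by (simp add: nn_integral_cmult nn_integral_add)
  also have "\<dots> \<le> ennreal (\<delta> / 2) * (1 + ennreal (1 / a') * ennreal a')"
    using pos_moment_le[OF A] a' by (intro mult_left_mono add_mono neg_moment_le) auto
  also have "\<dots> = ennreal \<delta>"
  proof -
    have "ennreal (1 / a') * ennreal a' = ennreal 1" using a' by (simp add: ennreal_mult[symmetric])
    then have "1 + ennreal (1 / a') * ennreal a' = ennreal 2"
      by (simp add: one_add_one)
    moreover have "ennreal (\<delta> / 2) * ennreal 2 = ennreal \<delta>"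
      using \<delta> by (subst ennreal_mult[symmetric]) auto
    ultimately show ?thesis by simp
  qed
  finally show ?thesis .
qed

text \<open>Passes to the complementary event. The two posterior masses add up to one for every
  sample, which avoids subtracting integrals in \<open>ennreal\<close>.\<close>

lemma gibbs_good_bound:
  assumes A: "A \<in> sets Pr" and a: "0 < a" "ennreal a \<le> emeasure Pr A"
    and s: "\<And>\<theta>. \<theta> \<in> A \<Longrightarrow> e \<theta> \<le> s"
    and \<delta>: "0 < \<delta>" "\<delta> < 1"
    and b: "t * real n * (\<alpha> * b - \<gamma> * s) \<ge> ln (1 / a) + 2 * ln (1 / \<delta>)"
  shows "(\<integral>\<^sup>+S. (\<integral>\<^sup>+\<theta>. ennreal (weight S \<theta>) * indicator {\<theta> \<in> space Pr. e \<theta> \<le> b} \<theta> \<partial>Pr)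
              / (\<integral>\<^sup>+\<theta>. ennreal (weight S \<theta>) \<partial>Pr) \<partial>Dn) \<ge> ennreal (1 - \<delta>)"
proof -
  let ?Q = "\<lambda>H S. (\<integral>\<^sup>+\<theta>. ennreal (weight S \<theta>) * indicator H \<theta> \<partial>Pr) / (\<integral>\<^sup>+\<theta>. ennreal (weight S \<theta>) \<partial>Pr)"
  let ?G = "{\<theta> \<in> space Pr. e \<theta> \<le> b}" and ?N = "{\<theta> \<in> space Pr. b < e \<theta>}"
  have "(\<lambda>(S, \<theta>). weight S \<theta>) \<in> borel_measurable (Dn \<Otimes>\<^sub>M Pr)"
    using measurable_pair_swap[OF weight_meas] by (simp add: case_prod_beta')
  note [measurable] = this
  have G [measurable]: "?G \<in> sets Pr" and N [measurable]: "?N \<in> sets Pr" by measurable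
  have Q [measurable]: "?Q H \<in> borel_measurable Dn" if [measurable]: "H \<in> sets Pr" for H by measurable
  have pt: "?Q ?G S + ?Q ?N S = 1" if S: "S \<in> space Dn" for S
  proof -
    note [measurable] = weight_meas_slice[OF S]
    have "?Q ?G S + ?Q ?N S = (\<integral>\<^sup>+\<theta>. ennreal (weight S \<theta>) * indicator ?G \<theta> + ennreal (weight S \<theta>) * indicator ?N \<theta> \<partial>Pr)
       / (\<integral>\<^sup>+\<theta>. ennreal (weight S \<theta>) \<partial>Pr)"
      by (subst nn_integral_add) (auto simp: add_divide_distrib_ennreal)
    also have "(\<integral>\<^sup>+\<theta>. ennreal (weight S \<theta>) * indicator ?G \<theta> + ennreal (weight S \<theta>) * indicator ?N \<theta> \<partial>Pr)
       = (\<integral>\<^sup>+\<theta>. ennreal (weight S \<theta>) \<partial>Pr)"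
      by (rule nn_integral_cong) (auto simp: indicator_def)
    also have "(\<integral>\<^sup>+\<theta>. ennreal (weight S \<theta>) \<partial>Pr) / (\<integral>\<^sup>+\<theta>. ennreal (weight S \<theta>) \<partial>Pr) = 1"
      using partition_pos[OF S] partition_le_1[of S]
      by (intro ennreal_divide_self) (auto intro: le_less_trans[OF _ ennreal_one_less_top])
    finally show ?thesis .
  qed
  have "1 = (\<integral>\<^sup>+S. ?Q ?G S + ?Q ?N S \<partial>Dn)"
    using prod.emeasure_space_1 by (simp add: pt cong: nn_integral_cong)
  also have "\<dots> = (\<integral>\<^sup>+S. ?Q ?G S \<partial>Dn) + (\<integral>\<^sup>+S. ?Q ?N S \<partial>Dn)"
    by (rule nn_integral_add) (rule Q, measurable)+
  also have "\<dots> \<le> (\<integral>\<^sup>+S. ?Q ?G S \<partial>Dn) + ennreal \<delta>"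
    by (intro add_left_mono gibbs_tail_bound[OF A a s \<delta>(1) b])
  finally have le: "1 \<le> (\<integral>\<^sup>+S. ?Q ?G S \<partial>Dn) + ennreal \<delta>" .
  show ?thesis
  proof (cases "(\<integral>\<^sup>+S. ?Q ?G S \<partial>Dn)")
    case (real x)
    then have "1 \<le> x + \<delta>"
      using le \<delta> by (simp add: ennreal_plus[symmetric] del: ennreal_plus)
    then show ?thesis using real by (simp add: ennreal_leI)
  qed simp
qed

end

section \<open>Networks as functions of their parameters\<close>

text \<open>Images of finite rectangles under injective maps give both finiteness and the parameter
  count. The unions nest to the right so that disjoint pieces can be split off one at a
  time.\<close>

lemma param_idx_eq:
  "param_idx p r L = (\<lambda>(k, j). W1 k j) ` ({..<r} \<times> {..<p}) \<union> (V1 ` {..<r} \<union>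
     ((\<lambda>(l, k, k'). Wh l k k') ` ({2..L} \<times> {..<r} \<times> {..<r}) \<union>
     ((\<lambda>(l, k). Vh l k) ` ({2..L} \<times> {..<r}) \<union> (Wo ` {..<r} \<union> {Vo}))))"
  unfolding param_idx_def by (auto simp: image_iff)

lemma finite_param_idx [simp]: "finite (param_idx p r L)"
  unfolding param_idx_eq by simp

lemma param_idx_nonempty [simp]: "param_idx p r L \<noteq> {}"
  by (simp add: param_idx_def)

lemma card_param_idx: "card (param_idx p r L) = num_params p r L"
proof -
  have inj: "inj_on (\<lambda>(k, j). W1 k j) X" "inj_on (\<lambda>(l, k, k'). Wh l k k') Y"
    "inj_on (\<lambda>(l, k). Vh l k) Z" "inj_on V1 U" "inj_on Wo U" for X Y Z U
    by (auto simp: inj_on_def)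
  show ?thesis
    \<comment> \<open>The case split on \<open>L\<close> settles the truncated subtraction: there
      are \<open>L - 1\<close> layers from 2 to \<open>L\<close>, also when \<open>L\<close> is
      zero.\<close>
    unfolding param_idx_eq num_params_def
    by (subst card_Un_disjoint, simp, simp, fastforce)+
       (cases L; simp add: card_image inj algebra_simps)
qed

lemma in_param_idx [simp]:
  "W1 k j \<in> param_idx p r L \<longleftrightarrow> k < r \<and> j < p"
  "V1 k \<in> param_idx p r L \<longleftrightarrow> k < r"
  "Wh l k k' \<in> param_idx p r L \<longleftrightarrow> 2 \<le> l \<and> l \<le> L \<and> k < r \<and> k' < r"
  "Vh l k \<in> param_idx p r L \<longleftrightarrow> 2 \<le> l \<and> l \<le> L \<and> k < r"
  "Wo k \<in> param_idx p r L \<longleftrightarrow> k < r"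
  "Vo \<in> param_idx p r L"
  by (auto simp: param_idx_def)

section \<open>Lipschitz dependence of networks on their parameters\<close>

lemma abs_affine_le:
  fixes a u :: "nat \<Rightarrow> real"
  assumes "\<And>i. i < m \<Longrightarrow> \<bar>a i\<bar> \<le> B" "\<bar>c\<bar> \<le> B" "\<And>i. i < m \<Longrightarrow> \<bar>u i\<bar> \<le> U" "0 \<le> B"
  shows "\<bar>(\<Sum>i<m. a i * u i) + c\<bar> \<le> real m * (B * U) + B"
proof -
  have "\<bar>\<Sum>i<m. a i * u i\<bar> \<le> (\<Sum>i<m. \<bar>a i * u i\<bar>)" by (rule sum_abs)
  also have "\<dots> \<le> (\<Sum>i<m. B * U)"
    unfolding abs_mult by (intro sum_mono mult_mono) (use assms in auto)
  finally show ?thesis using assms(2) by simp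
qed

text \<open>Weights and inputs are changed one after the other: the error in the weights is
  multiplied by the size of the input, and the error in the input by the size of the
  weights.\<close>

lemma abs_affine_diff_le:
  fixes a b u v :: "nat \<Rightarrow> real"
  assumes "\<And>i. i < m \<Longrightarrow> \<bar>b i\<bar> \<le> B" "\<And>i. i < m \<Longrightarrow> \<bar>a i - b i\<bar> \<le> \<eta>" "\<bar>c - d\<bar> \<le> \<eta>"
    "\<And>i. i < m \<Longrightarrow> \<bar>u i\<bar> \<le> U" "\<And>i. i < m \<Longrightarrow> \<bar>u i - v i\<bar> \<le> V" "0 \<le> B"
  shows "\<bar>((\<Sum>i<m. a i * u i) + c) - ((\<Sum>i<m. b i * v i) + d)\<bar> \<le> real m * (\<eta> * U + B * V) + \<eta>"
proof -
  have \<eta>: "0 \<le> \<eta>" using assms(3) by linarith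
  have "\<bar>(\<Sum>i<m. a i * u i) - (\<Sum>i<m. b i * v i)\<bar> \<le> (\<Sum>i<m. \<bar>a i * u i - b i * v i\<bar>)"
    unfolding sum_subtractf[symmetric] by (rule sum_abs)
  also have "\<dots> \<le> (\<Sum>i<m. \<eta> * U + B * V)"
  proof (rule sum_mono)
    fix i assume i: "i \<in> {..<m}"
    have "\<bar>a i * u i - b i * v i\<bar> = \<bar>(a i - b i) * u i + b i * (u i - v i)\<bar>"
      by (simp add: algebra_simps)
    also have "\<dots> \<le> \<bar>a i - b i\<bar> * \<bar>u i\<bar> + \<bar>b i\<bar> * \<bar>u i - v i\<bar>"
      unfolding abs_mult[symmetric] by (rule abs_triangle_ineq)
    also have "\<dots> \<le> \<eta> * U + B * V"
      by (intro add_mono mult_mono) (use assms i \<eta> in auto)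
    finally show "\<bar>a i * u i - b i * v i\<bar> \<le> \<eta> * U + B * V" .
  qed
  finally show ?thesis using assms(3) by simp
qed

lemma abs_relu_le: "\<bar>relu a\<bar> \<le> \<bar>a\<bar>" and abs_relu_diff_le: "\<bar>relu a - relu b\<bar> \<le> \<bar>a - b\<bar>"
  by (auto simp: relu_def max_def)

text \<open>Proximity in the sup norm is bundled with membership in the cube, since the Lipschitz
  constants depend on \<open>B\<close>. As \<open>Vo\<close> is always an index, \<eta> is forced to
  be nonnegative.\<close>

definition close_params :: "real \<Rightarrow> nat \<Rightarrow> nat \<Rightarrow> nat \<Rightarrow> real \<Rightarrow> (pidx \<Rightarrow> real) \<Rightarrow> (pidx \<Rightarrow> real) \<Rightarrow> bool" where
  "close_params B p r L \<eta> \<theta> \<theta>' \<longleftrightarrow>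
     (\<forall>i\<in>param_idx p r L. \<bar>\<theta> i\<bar> \<le> B \<and> \<bar>\<theta>' i\<bar> \<le> B \<and> \<bar>\<theta> i - \<theta>' i\<bar> \<le> \<eta>)"

lemma close_paramsD:
  assumes "close_params B p r L \<eta> \<theta> \<theta>'" "i \<in> param_idx p r L"
  shows "\<bar>\<theta> i\<bar> \<le> B" "\<bar>\<theta>' i\<bar> \<le> B" "\<bar>\<theta> i - \<theta>' i\<bar> \<le> \<eta>"
  using assms by (auto simp: close_params_def)

text \<open>Size and difference are bounded in one induction, because the difference at the next
  layer involves the size at this one. The constant is uniform in the parameters, the input and
  \<eta>; its value matters only for how large n must be.\<close>

lemma hidden_lipschitz:
  assumes B: "0 \<le> B" and "m < L"
  shows "\<exists>M\<ge>0. \<forall>\<theta> \<theta>' x \<eta> k. close_params B p r L \<eta> \<theta> \<theta>' \<longrightarrow> k < r \<longrightarrow>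
     \<bar>hidden p r \<theta> x m k\<bar> \<le> M * (1 + (\<Sum>j<p. \<bar>x j\<bar>)) \<and>
     \<bar>hidden p r \<theta> x m k - hidden p r \<theta>' x m k\<bar> \<le> M * \<eta> * (1 + (\<Sum>j<p. \<bar>x j\<bar>))"
  using \<open>m < L\<close>
proof (induction m)
  case 0
  let ?M = "real p * B + B + real p + 1"
  show ?case
  proof (intro exI[of _ ?M] conjI allI impI)
    show "0 \<le> ?M" using B by simp
    fix \<theta> \<theta>' :: "pidx \<Rightarrow> real" and x :: "nat \<Rightarrow> real" and \<eta> :: real and k
    assume cl: "close_params B p r L \<eta> \<theta> \<theta>'" and k: "k < r"
    define N where "N = 1 + (\<Sum>j<p. \<bar>x j\<bar>)"
    have N1: "1 \<le> N" by (simp add: N_def sum_nonneg)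
    have xN: "\<bar>x j\<bar> \<le> N" if "j < p" for j
      using member_le_sum[of j "{..<p}" "\<lambda>j. \<bar>x j\<bar>"] that by (simp add: N_def)
    note c = close_paramsD[OF cl]
    have \<eta>: "0 \<le> \<eta>" using c(3)[of Vo] by simp
    have "\<bar>hidden p r \<theta> x 0 k\<bar> \<le> real p * (B * N) + B"
      unfolding hidden.simps
      by (rule order_trans[OF abs_relu_le abs_affine_le]) (use c(1) k xN B in auto)
    also have "\<dots> \<le> ?M * N"
    proof -
      have "B \<le> B * N" "0 \<le> real p * N" using mult_left_mono[OF N1 B] N1 by auto
      then have "real p * (B * N) + B \<le> real p * (B * N) + B * N + real p * N + N" using N1 by linarith
      also have "\<dots> = ?M * N" by (simp add: algebra_simps)
      finally show ?thesis .
    qed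
    finally show "\<bar>hidden p r \<theta> x 0 k\<bar> \<le> ?M * N" .
    \<comment> \<open>Both networks read the same input, so the input error is zero here.\<close>
    have "\<bar>hidden p r \<theta> x 0 k - hidden p r \<theta>' x 0 k\<bar> \<le> real p * (\<eta> * N + B * 0) + \<eta>"
      unfolding hidden.simps
      by (rule order_trans[OF abs_relu_diff_le abs_affine_diff_le]) (use c k xN B in auto)
    also have "\<dots> \<le> (real p + 1) * \<eta> * N"
      using mult_left_mono[OF N1 \<eta>] by (simp add: algebra_simps)
    also have "\<dots> \<le> ?M * \<eta> * N"
      using B \<eta> N1 by (intro mult_right_mono) auto
    finally show "\<bar>hidden p r \<theta> x 0 k - hidden p r \<theta>' x 0 k\<bar> \<le> ?M * \<eta> * N" .
  qed
next
  case (Suc m)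
  then obtain M where M: "M \<ge> 0" and IH: "\<And>\<theta> \<theta>' x \<eta> k. close_params B p r L \<eta> \<theta> \<theta>' \<Longrightarrow> k < r \<Longrightarrow>
     \<bar>hidden p r \<theta> x m k\<bar> \<le> M * (1 + (\<Sum>j<p. \<bar>x j\<bar>)) \<and>
     \<bar>hidden p r \<theta> x m k - hidden p r \<theta>' x m k\<bar> \<le> M * \<eta> * (1 + (\<Sum>j<p. \<bar>x j\<bar>))"
    by (metis Suc_lessD)
  let ?M = "real r * B * M + B + real r * M + 1"
  show ?case
  proof (intro exI[of _ ?M] conjI allI impI)
    show "0 \<le> ?M" using B M by simp
    fix \<theta> \<theta>' :: "pidx \<Rightarrow> real" and x :: "nat \<Rightarrow> real" and \<eta> :: real and k
    assume cl: "close_params B p r L \<eta> \<theta> \<theta>'" and k: "k < r"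
    define N where "N = 1 + (\<Sum>j<p. \<bar>x j\<bar>)"
    have N1: "1 \<le> N" by (simp add: N_def sum_nonneg)
    note c = close_paramsD[OF cl]
    note IH' = IH[OF cl, of _ x, folded N_def]
    have \<eta>: "0 \<le> \<eta>" using c(3)[of Vo] by simp
    \<comment> \<open>Since \<open>hidden\<close> counts layers from zero, level
      \<open>Suc m\<close> uses the parameters of layer m + 2, which must still be among the
      indices.\<close>
    have L: "m + 2 \<le> L" using Suc.prems by simp
    have "\<bar>hidden p r \<theta> x (Suc m) k\<bar> \<le> real r * (B * (M * N)) + B"
      unfolding hidden.simps
      by (rule order_trans[OF abs_relu_le abs_affine_le]) (use c(1) k IH' B L in auto)
    also have "\<dots> \<le> ?M * N"
    proof -
      have "B \<le> B * N" "0 \<le> real r * M * N" using mult_left_mono[OF N1 B] N1 M by auto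
      then have "real r * (B * (M * N)) + B \<le> real r * (B * (M * N)) + B * N + real r * M * N + N" using N1 by linarith
      also have "\<dots> = ?M * N" by (simp add: algebra_simps)
      finally show ?thesis .
    qed
    finally show "\<bar>hidden p r \<theta> x (Suc m) k\<bar> \<le> ?M * N" .
    have "\<bar>hidden p r \<theta> x (Suc m) k - hidden p r \<theta>' x (Suc m) k\<bar>
        \<le> real r * (\<eta> * (M * N) + B * (M * \<eta> * N)) + \<eta>"
      unfolding hidden.simps
      by (rule order_trans[OF abs_relu_diff_le abs_affine_diff_le]) (use c k IH' B L in auto)
    also have "\<dots> \<le> (real r * B * M + real r * M + 1) * \<eta> * N"
      using mult_left_mono[OF N1 \<eta>] by (simp add: algebra_simps)
    also have "\<dots> \<le> ?M * \<eta> * N"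
      using B \<eta> N1 by (intro mult_right_mono) auto
    finally show "\<bar>hidden p r \<theta> x (Suc m) k - hidden p r \<theta>' x (Suc m) k\<bar> \<le> ?M * \<eta> * N" .
  qed
qed

text \<open>The output layer is one more affine step after the last hidden layer, numbered
  \<open>L - 1\<close>, and clipping is a contraction.\<close>

lemma clipped_net_lipschitz:
  assumes B: "0 \<le> B" and L: "1 \<le> L"
  shows "\<exists>M\<ge>0. \<forall>\<theta> \<theta>' x \<eta>. close_params B p r L \<eta> \<theta> \<theta>' \<longrightarrow>
     \<bar>clipped_net C p r L \<theta> x - clipped_net C p r L \<theta>' x\<bar> \<le> M * \<eta> * (1 + (\<Sum>j<p. \<bar>x j\<bar>))"
proof -
  obtain M where M: "M \<ge> 0" and IH: "\<And>\<theta> \<theta>' x \<eta> k. close_params B p r L \<eta> \<theta> \<theta>' \<Longrightarrow> k < r \<Longrightarrow>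
     \<bar>hidden p r \<theta> x (L - 1) k\<bar> \<le> M * (1 + (\<Sum>j<p. \<bar>x j\<bar>)) \<and>
     \<bar>hidden p r \<theta> x (L - 1) k - hidden p r \<theta>' x (L - 1) k\<bar> \<le> M * \<eta> * (1 + (\<Sum>j<p. \<bar>x j\<bar>))"
    using hidden_lipschitz[OF B, of "L - 1" L p r] L by auto
  let ?M = "real r * B * M + real r * M + 1"
  show ?thesis
  proof (intro exI[of _ ?M] conjI allI impI)
    show "0 \<le> ?M" using B M by simp
    fix \<theta> \<theta>' :: "pidx \<Rightarrow> real" and x :: "nat \<Rightarrow> real" and \<eta> :: real
    assume cl: "close_params B p r L \<eta> \<theta> \<theta>'"
    define N where "N = 1 + (\<Sum>j<p. \<bar>x j\<bar>)"
    have N1: "1 \<le> N" by (simp add: N_def sum_nonneg)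
    note c = close_paramsD[OF cl]
    note IH' = IH[OF cl, of _ x, folded N_def]
    have \<eta>: "0 \<le> \<eta>" using c(3)[of Vo] by simp
    have "\<bar>clipped_net C p r L \<theta> x - clipped_net C p r L \<theta>' x\<bar> \<le> \<bar>net p r L \<theta> x - net p r L \<theta>' x\<bar>"
      by (auto simp: clipped_net_def max_def min_def)
    also have "\<dots> \<le> real r * (\<eta> * (M * N) + B * (M * \<eta> * N)) + \<eta>"
      unfolding net_def by (rule abs_affine_diff_le) (use c IH' B in auto)
    also have "\<dots> \<le> ?M * \<eta> * N"
      using mult_left_mono[OF N1 \<eta>] by (simp add: algebra_simps)
    finally show "\<bar>clipped_net C p r L \<theta> x - clipped_net C p r L \<theta>' x\<bar> \<le> ?M * \<eta> * N" .
  qed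
qed

section \<open>Joint measurability in parameters and input\<close>

lemma param_component_measurable [measurable]:
  "i \<in> param_idx p r L \<Longrightarrow> (\<lambda>\<theta>. \<theta> i) \<in> borel_measurable (param_space p r L)"
  unfolding param_space_def by (rule measurable_component_singleton)

lemma input_component_measurable [measurable]:
  "j < p \<Longrightarrow> (\<lambda>x. x j) \<in> borel_measurable (input_space p)"
  unfolding input_space_def by (rule measurable_component_singleton) simp

lemma relu_measurable [measurable]: "relu \<in> borel_measurable borel"
  unfolding relu_def[abs_def] by measurable

lemma hidden_measurable:
  assumes "m < L" "k < r"
  shows "(\<lambda>(\<theta>, x). hidden p r \<theta> x m k) \<in> borel_measurable (param_space p r L \<Otimes>\<^sub>M input_space p)"
  using assms
proof (induction m arbitrary: k)
  case 0
  have [measurable]: "(\<lambda>y. fst y i) \<in> borel_measurable (param_space p r L \<Otimes>\<^sub>M input_space p)"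
    if "i \<in> param_idx p r L" for i
    by (rule measurable_compose[OF measurable_fst param_component_measurable[OF that]])
  have [measurable]: "(\<lambda>y. snd y j) \<in> borel_measurable (param_space p r L \<Otimes>\<^sub>M input_space p)"
    if "j < p" for j
    by (rule measurable_compose[OF measurable_snd input_component_measurable[OF that]])
  show ?case using 0
    by (auto simp: case_prod_beta' intro!: measurable_compose[OF _ relu_measurable] borel_measurable_add
          borel_measurable_sum borel_measurable_times)
next
  case (Suc m)
  have [measurable]: "(\<lambda>y. fst y i) \<in> borel_measurable (param_space p r L \<Otimes>\<^sub>M input_space p)"
    if "i \<in> param_idx p r L" for i
    by (rule measurable_compose[OF measurable_fst param_component_measurable[OF that]])
  have IH: "(\<lambda>y. hidden p r (fst y) (snd y) m k') \<in> borel_measurable (param_space p r L \<Otimes>\<^sub>M input_space p)"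
    if "k' < r" for k'
    using Suc.IH[of k'] Suc.prems that by (simp add: case_prod_beta')
  show ?case using Suc.prems IH
    by (auto simp: case_prod_beta' intro!: measurable_compose[OF _ relu_measurable] borel_measurable_add
          borel_measurable_sum borel_measurable_times)
qed

text \<open>Joint measurability is what exchanging prior and sample by Fubini requires.\<close>

lemma clipped_net_measurable:
  assumes "1 \<le> L"
  shows "(\<lambda>(\<theta>, x). clipped_net C p r L \<theta> x) \<in> borel_measurable (param_space p r L \<Otimes>\<^sub>M input_space p)"
proof -
  have [measurable]: "(\<lambda>y. fst y i) \<in> borel_measurable (param_space p r L \<Otimes>\<^sub>M input_space p)"
    if "i \<in> param_idx p r L" for i
    by (rule measurable_compose[OF measurable_fst param_component_measurable[OF that]])
  have "(\<lambda>y. hidden p r (fst y) (snd y) (L - 1) k) \<in> borel_measurable (param_space p r L \<Otimes>\<^sub>M input_space p)"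
    if "k < r" for k
    using hidden_measurable[of "L - 1" L k r p] assms that by (simp add: case_prod_beta')
  then have "(\<lambda>y. net p r L (fst y) (snd y)) \<in> borel_measurable (param_space p r L \<Otimes>\<^sub>M input_space p)"
    unfolding net_def by (auto intro!: borel_measurable_add borel_measurable_sum borel_measurable_times)
  then show ?thesis unfolding clipped_net_def case_prod_beta' by measurable
qed

lemma clipped_net_bound: "0 \<le> C \<Longrightarrow> \<bar>clipped_net C p r L \<theta> x\<bar> \<le> C"
  by (auto simp: clipped_net_def)

section \<open>The sparsity prior\<close>

abbreviation coord_prior :: "real \<Rightarrow> pidx set \<Rightarrow> pidx \<Rightarrow> real measure" where
  "coord_prior B I \<equiv> (\<lambda>i. if i \<in> I then uniform_measure lborel {-B..B} else return borel 0)"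

lemma prob_space_coord_prior: "0 < B \<Longrightarrow> prob_space (coord_prior B I i)"
  by (auto intro!: prob_space_uniform_measure prob_space_return)

lemma sets_prior_I: "sets (prior_I B p r L I) = sets (param_space p r L)"
  unfolding prior_I_def param_space_def by (rule sets_PiM_cong) auto

lemma prob_space_prior_I: "0 < B \<Longrightarrow> prob_space (prior_I B p r L I)"
  unfolding prior_I_def by (intro prob_space_PiM prob_space_coord_prior)

text \<open>The set function inside \<open>prior\<close>, named so that its countable additivity can
  be proved; \<open>measure_of\<close> returns these values only once that is known.\<close>

definition prior_mass :: "real \<Rightarrow> nat \<Rightarrow> nat \<Rightarrow> nat \<Rightarrow> (pidx \<Rightarrow> real) set \<Rightarrow> ennreal" where
  "prior_mass B p r L A =
     (\<Sum>i\<in>{1..num_params p r L}. ennreal (2 powr (- real i)) *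
        (\<Sum>I\<in>{I. I \<subseteq> param_idx p r L \<and> card I = i}.
           ennreal (1 / (real (num_params p r L choose i) * (1 - 2 powr (- real (num_params p r L)))))
             * emeasure (prior_I B p r L I) A))"

lemma sets_prior [simp, measurable_cong]: "sets (prior B p r L) = sets (param_space p r L)"
  and space_prior [simp]: "space (prior B p r L) = space (param_space p r L)"
  unfolding prior_def Let_def
  by (simp_all add: sets.space_closed sets.sigma_sets_eq)

lemma emeasure_prior:
  assumes A: "A \<in> sets (param_space p r L)"
  shows "emeasure (prior B p r L) A = prior_mass B p r L A"
proof (rule emeasure_measure_of)
  show "prior B p r L = measure_of (space (param_space p r L)) (sets (param_space p r L)) (prior_mass B p r L)"
    unfolding prior_def prior_mass_def[abs_def] Let_def ..
  show "sets (param_space p r L) \<subseteq> Pow (space (param_space p r L))" by (rule sets.space_closed)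
  show "positive (sets (prior B p r L)) (prior_mass B p r L)"
    by (simp add: positive_def prior_mass_def)
  show "countably_additive (sets (prior B p r L)) (prior_mass B p r L)"
  proof (rule countably_additiveI)
    fix X :: "nat \<Rightarrow> (pidx \<Rightarrow> real) set"
    assume X: "range X \<subseteq> sets (prior B p r L)" "disjoint_family X"
    have "(\<Sum>n. emeasure (prior_I B p r L I) (X n)) = emeasure (prior_I B p r L I) (\<Union>n. X n)" for I
      by (rule suminf_emeasure) (use X in \<open>auto simp: sets_prior_I\<close>)
    then show "(\<Sum>n. prior_mass B p r L (X n)) = prior_mass B p r L (\<Union>n. X n)"
      unfolding prior_mass_def
      by (simp add: suminf_sum[OF summableI])
  qed
  show "A \<in> sets (prior B p r L)" using A by simp
qed

lemma sum_geometric_half: "(\<Sum>i\<in>{1..m}. 2 powr (- real i)) = 1 - 2 powr (- real m)"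
proof (induction m)
  case (Suc m)
  have "2 powr (- real m) = 2 powr (1 + - real (Suc m))" by simp
  also have "\<dots> = 2 * 2 powr (- real (Suc m))" by (subst powr_add) simp
  finally have "2 powr (- real m) = 2 * 2 powr (- real (Suc m))" .
  with Suc show ?case by (simp add: atLeastAtMostSuc_conv)
qed simp

lemma num_params_pos: "0 < num_params p r L"
  by (simp add: num_params_def)

lemma prior_normalizer: "0 < 1 - 2 powr (- real (num_params p r L))"
  using num_params_pos[of p r L] powr_less_mono[of "- real (num_params p r L)" 0 2] by simp

text \<open>At each sparsity level the binomial coefficient cancels the number of index sets, and
  the geometric level weights add up to the normaliser.\<close>

lemma prob_space_prior:
  assumes "0 < B"
  shows "prob_space (prior B p r L)"
proof
  let ?P = "num_params p r L"
  let ?CP = "1 - 2 powr (- real ?P)"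
  let ?idx = "param_idx p r L"
  have "emeasure (prior B p r L) (space (prior B p r L)) = prior_mass B p r L (space (param_space p r L))"
    using emeasure_prior[OF sets.top] by simp
  also have "\<dots> = (\<Sum>i\<in>{1..?P}. ennreal (2 powr (- real i) / ?CP))"
    unfolding prior_mass_def
  proof (rule sum.cong[OF refl])
    fix i assume i: "i \<in> {1..?P}"
    have space1: "emeasure (prior_I B p r L I) (space (param_space p r L)) = 1" for I
      using prob_space.emeasure_space_1[OF prob_space_prior_I[OF assms, of p r L I]]
      by (simp add: sets_eq_imp_space_eq[OF sets_prior_I])
    have card: "card {I. I \<subseteq> ?idx \<and> card I = i} = ?P choose i"
      by (subst n_subsets) (simp_all add: card_param_idx)
    have pos: "real (?P choose i) > 0" using i by simp
    have "ennreal (2 powr (- real i)) * (\<Sum>I\<in>{I. I \<subseteq> ?idx \<and> card I = i}.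
        ennreal (1 / (real (?P choose i) * ?CP)) * emeasure (prior_I B p r L I) (space (param_space p r L)))
      = ennreal (2 powr (- real i)) * (ennreal (real (?P choose i)) * ennreal (1 / (real (?P choose i) * ?CP)))"
      by (simp add: space1 card ennreal_of_nat_eq_real_of_nat)
    also have "\<dots> = ennreal (2 powr (- real i) * (real (?P choose i) * (1 / (real (?P choose i) * ?CP))))"
    proof -
      have q: "0 \<le> 1 / (real (?P choose i) * ?CP)"
        using prior_normalizer[of p r L] pos by (intro divide_nonneg_nonneg mult_nonneg_nonneg) auto
      have "0 \<le> real (?P choose i) * (1 / (real (?P choose i) * ?CP))"
        using q by (intro mult_nonneg_nonneg) auto
      then show ?thesis
        using ennreal_mult[OF of_nat_0_le_iff q] by (simp only: ennreal_mult[OF powr_ge_zero])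
    qed
    also have "\<dots> = ennreal (2 powr (- real i) / ?CP)" using pos by simp
    finally show "ennreal (2 powr (- real i)) * (\<Sum>I\<in>{I. I \<subseteq> ?idx \<and> card I = i}.
        ennreal (1 / (real (?P choose i) * ?CP)) * emeasure (prior_I B p r L I) (space (param_space p r L)))
      = ennreal (2 powr (- real i) / ?CP)" .
  qed
  also have "\<dots> = ennreal (\<Sum>i\<in>{1..?P}. 2 powr (- real i) / ?CP)"
    using prior_normalizer[of p r L] by (subst sum_ennreal) auto
  also have "\<dots> = 1"
    unfolding sum_divide_distrib[symmetric] sum_geometric_half
    using prior_normalizer[of p r L] num_params_pos[of p r L] by simp
  finally show "emeasure (prior B p r L) (space (prior B p r L)) = 1" .
qed

section \<open>Prior mass of small boxes\<close>

definition param_ball :: "real \<Rightarrow> nat \<Rightarrow> nat \<Rightarrow> nat \<Rightarrow> real \<Rightarrow> (pidx \<Rightarrow> real) \<Rightarrow> (pidx \<Rightarrow> real) set" where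
  "param_ball B p r L \<eta> \<theta>' =
     PiE (param_idx p r L) (\<lambda>i. {max (- B) (\<theta>' i - \<eta>)..min B (\<theta>' i + \<eta>)})"

lemma param_ball_sets [measurable]: "param_ball B p r L \<eta> \<theta>' \<in> sets (param_space p r L)"
  unfolding param_ball_def param_space_def by (rule sets_PiM_I_finite) auto

lemma emeasure_coord_prior_interval:
  assumes B: "1 \<le> B" and \<eta>: "0 < \<eta>" "\<eta> \<le> 1" and c: "\<bar>c\<bar> \<le> B"
  shows "ennreal (\<eta> / (2 * B)) \<le> emeasure (uniform_measure lborel {-B..B}) {max (- B) (c - \<eta>)..min B (c + \<eta>)}"
proof -
  let ?J = "{max (- B) (c - \<eta>)..min B (c + \<eta>)}"
  \<comment> \<open>When the centre lies on the boundary of the cube, half of the interval is cut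
    off; length \<eta> remains in every case because \<open>\<eta> \<le> 1 \<le> B\<close>.\<close>
  have le: "max (- B) (c - \<eta>) + \<eta> \<le> min B (c + \<eta>)" using assms by (auto simp: max_def min_def)
  have J: "{- B..B} \<inter> ?J = ?J" by auto
  have "ennreal (\<eta> / (2 * B)) = ennreal \<eta> / ennreal (2 * B)"
    using B \<eta> by (simp add: divide_ennreal)
  also have "\<dots> \<le> ennreal (min B (c + \<eta>) - max (- B) (c - \<eta>)) / ennreal (2 * B)"
    by (intro divide_right_mono_ennreal ennreal_leI) (use le in linarith)
  also have "\<dots> = emeasure (uniform_measure lborel {-B..B}) ?J"
  proof -
    have "emeasure lborel ?J = ennreal (min B (c + \<eta>) - max (- B) (c - \<eta>))"
      by (rule emeasure_lborel_Icc) (use le \<eta> in linarith)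
    moreover have "emeasure lborel {- B..B} = ennreal (2 * B)" using B by simp
    ultimately show ?thesis by (subst emeasure_uniform_measure) (simp_all only: J, simp_all)
  qed
  finally show ?thesis .
qed

text \<open>The box is a product, so its mass factorises. Coordinates outside \<open>I\<close> sit
  at zero, which is also the value of the centre there, and contribute a factor one.\<close>

lemma emeasure_prior_I_param_ball:
  assumes B: "1 \<le> B" and \<eta>: "0 < \<eta>" "\<eta> \<le> 1" and I: "I \<subseteq> param_idx p r L"
    and \<theta>': "\<theta>' \<in> support_set B p r L I"
  shows "ennreal ((\<eta> / (2 * B)) ^ card I) \<le> emeasure (prior_I B p r L I) (param_ball B p r L \<eta> \<theta>')"
proof -
  let ?idx = "param_idx p r L"
  let ?J = "\<lambda>i. {max (- B) (\<theta>' i - \<eta>)..min B (\<theta>' i + \<eta>)}"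
  interpret product_prob_space "coord_prior B I" ?idx
    by (rule product_prob_spaceI) (use B prob_space_coord_prior in auto)
  have "ennreal ((\<eta> / (2 * B)) ^ card I) = (\<Prod>i\<in>I. ennreal (\<eta> / (2 * B)))"
    using B \<eta> by (simp add: ennreal_power)
  also have "\<dots> = (\<Prod>i\<in>?idx. if i \<in> I then ennreal (\<eta> / (2 * B)) else 1)"
    using I by (simp add: prod.If_cases Int_absorb1)
  also have "\<dots> \<le> (\<Prod>i\<in>?idx. emeasure (coord_prior B I i) (?J i))"
  proof (rule prod_mono_ennreal)
    fix i assume i: "i \<in> ?idx"
    have b: "\<bar>\<theta>' i\<bar> \<le> B" and z: "i \<notin> I \<Longrightarrow> \<theta>' i = 0"
      using \<theta>' i by (auto simp: support_set_def)
    show "(if i \<in> I then ennreal (\<eta> / (2 * B)) else 1) \<le> emeasure (coord_prior B I i) (?J i)"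
      using emeasure_coord_prior_interval[OF B \<eta> b] z B \<eta> by (auto simp: indicator_def)
  qed
  also have "\<dots> = emeasure (prior_I B p r L I) (param_ball B p r L \<eta> \<theta>')"
    unfolding prior_I_def param_ball_def by (rule emeasure_PiM[symmetric]) auto
  finally show ?thesis .
qed

text \<open>Only the component of the mixture belonging to \<open>I\<close> itself is kept. Each of
  its coordinates costs 2 B for the uniform density, 2 for the sparsity level and P for choosing
  \<open>I\<close>, as the binomial coefficient is at most the \<open>card I\<close>-th power of P
  and the normaliser is at most one.\<close>

lemma emeasure_prior_param_ball:
  assumes B: "1 \<le> B" and \<eta>: "0 < \<eta>" "\<eta> \<le> 1" and I: "I \<subseteq> param_idx p r L" "I \<noteq> {}"
    and \<theta>': "\<theta>' \<in> support_set B p r L I"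
  shows "ennreal ((\<eta> / (4 * B * real (num_params p r L))) ^ card I)
          \<le> emeasure (prior B p r L) (param_ball B p r L \<eta> \<theta>')"
proof -
  let ?P = "num_params p r L"
  let ?CP = "1 - 2 powr (- real ?P)"
  let ?A = "param_ball B p r L \<eta> \<theta>'"
  let ?k = "card I"
  have P: "0 < ?P" by (rule num_params_pos)
  have fin: "finite I" using finite_subset[OF I(1) finite_param_idx] .
  have k: "1 \<le> ?k" "?k \<le> ?P"
    using I fin card_mono[OF finite_param_idx I(1)] by (auto simp: card_param_idx Suc_le_eq card_gt_0_iff)
  have weight: "(1 / 2) ^ ?k * (1 / real ?P ^ ?k) \<le> 2 powr (- real ?k) * (1 / (real (?P choose ?k) * ?CP))"
  proof -
    have "real (?P choose ?k) * ?CP \<le> real (?P choose ?k) * 1" by (intro mult_left_mono) auto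
    also have "\<dots> \<le> real ?P ^ ?k"
      using binomial_le_pow[OF k(2)] by (simp flip: of_nat_power)
    finally have "1 / real ?P ^ ?k \<le> 1 / (real (?P choose ?k) * ?CP)"
      using k P prior_normalizer[of p r L] by (intro divide_left_mono) auto
    moreover have "(1 / 2) ^ ?k = (2::real) powr (- real ?k)"
      by (simp add: powr_minus powr_realpow power_one_over inverse_eq_divide)
    ultimately show ?thesis by (simp only:) (intro mult_left_mono, auto)
  qed
  have "(\<eta> / (4 * B * real ?P)) ^ ?k = (1 / 2) ^ ?k * (1 / real ?P ^ ?k) * (\<eta> / (2 * B)) ^ ?k"
  proof -
    have "\<eta> / (4 * B * real ?P) = 1 / 2 * (1 / real ?P) * (\<eta> / (2 * B))" by simp
    then show ?thesis by (simp only: power_mult_distrib power_one_over)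
  qed
  also have "\<dots> \<le> 2 powr (- real ?k) * (1 / (real (?P choose ?k) * ?CP)) * (\<eta> / (2 * B)) ^ ?k"
    by (rule mult_right_mono[OF weight]) (use \<eta> B in auto)
  finally have "ennreal ((\<eta> / (4 * B * real ?P)) ^ ?k) \<le>
      ennreal (2 powr (- real ?k) * (1 / (real (?P choose ?k) * ?CP)) * (\<eta> / (2 * B)) ^ ?k)"
    by (rule ennreal_leI)
  also have "\<dots> = ennreal (2 powr (- real ?k)) * (ennreal (1 / (real (?P choose ?k) * ?CP)) * ennreal ((\<eta> / (2 * B)) ^ ?k))"
    using \<eta> B prior_normalizer[of p r L] by (simp add: ennreal_mult mult.assoc del: times_divide_eq_right times_divide_eq_left)
  also have "\<dots> \<le> ennreal (2 powr (- real ?k)) * (ennreal (1 / (real (?P choose ?k) * ?CP)) * emeasure (prior_I B p r L I) ?A)"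
    by (intro mult_left_mono emeasure_prior_I_param_ball B \<eta> I \<theta>') auto
  also have "\<dots> \<le> ennreal (2 powr (- real ?k)) * (\<Sum>I'\<in>{I'. I' \<subseteq> param_idx p r L \<and> card I' = ?k}.
      ennreal (1 / (real (?P choose ?k) * ?CP)) * emeasure (prior_I B p r L I') ?A)"
  proof (intro mult_left_mono)
    show "ennreal (1 / (real (?P choose ?k) * ?CP)) * emeasure (prior_I B p r L I) ?A \<le>
        (\<Sum>I'\<in>{I'. I' \<subseteq> param_idx p r L \<and> card I' = ?k}.
          ennreal (1 / (real (?P choose ?k) * ?CP)) * emeasure (prior_I B p r L I') ?A)"
      by (rule member_le_sum[where f = "\<lambda>I'. ennreal (1 / (real (?P choose ?k) * ?CP)) * emeasure (prior_I B p r L I') ?A"])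
         (use I in auto)
  qed simp
  also have "\<dots> \<le> prior_mass B p r L ?A"
    unfolding prior_mass_def
    by (rule member_le_sum[where f = "\<lambda>i. ennreal (2 powr (- real i)) *
          (\<Sum>I'\<in>{I'. I' \<subseteq> param_idx p r L \<and> card I' = i}.
          ennreal (1 / (real (?P choose i) * ?CP)) * emeasure (prior_I B p r L I') ?A)"]) (use k in auto)
  also have "\<dots> = emeasure (prior B p r L) ?A" by (simp add: emeasure_prior)
  finally show ?thesis .
qed

lemma param_ball_close:
  assumes "\<theta> \<in> param_ball B p r L \<eta> \<theta>'" "\<theta>' \<in> support_set B p r L I"
  shows "close_params B p r L \<eta> \<theta> \<theta>'"
  unfolding close_params_def
proof
  fix i assume i: "i \<in> param_idx p r L"
  then have "\<theta> i \<in> {max (- B) (\<theta>' i - \<eta>)..min B (\<theta>' i + \<eta>)}"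
    using assms(1) unfolding param_ball_def by (rule PiE_mem[rotated])
  then have "- B \<le> \<theta> i" "\<theta> i \<le> B" "\<theta>' i - \<eta> \<le> \<theta> i" "\<theta> i \<le> \<theta>' i + \<eta>" by auto
  moreover have "\<bar>\<theta>' i\<bar> \<le> B" using assms(2) i by (simp add: support_set_def)
  ultimately show "\<bar>\<theta> i\<bar> \<le> B \<and> \<bar>\<theta>' i\<bar> \<le> B \<and> \<bar>\<theta> i - \<theta>' i\<bar> \<le> \<eta>" by (auto simp: abs_le_iff)
qed

section \<open>The oracle inequality\<close>

context bernstein_regression
begin

text \<open>From (a - b)^2 <= 2 a^2 + 2 b^2. This factor 2, times the ratio 2 of the moment
  coefficients 4/3 and 2/3, produces the 4 of the oracle inequality.\<close>

lemma excess_risk_le_twice: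
  assumes [measurable]: "\<phi> \<in> borel_measurable (input_space p)" "\<psi> \<in> borel_measurable (input_space p)"
    and \<phi>: "\<And>x. \<bar>\<phi> x\<bar> \<le> C" and \<psi>: "\<And>x. \<bar>\<psi> x\<bar> \<le> C"
  shows "excess_risk D f \<phi> \<le> 2 * excess_risk D f \<psi> + 2 * (\<integral>z. (\<phi> (fst z) - \<psi> (fst z))\<^sup>2 \<partial>D)"
proof -
  note [measurable] = fst_measurable_D
  have "\<bar>(\<phi> x - \<psi> x)\<^sup>2\<bar> \<le> (2 * C)\<^sup>2" for x
    using power_mono[of "\<bar>\<phi> x - \<psi> x\<bar>" "2 * C" 2] \<phi>[of x] \<psi>[of x] by simp
  then have int: "integrable D (\<lambda>z. (\<phi> (fst z) - \<psi> (fst z))\<^sup>2)"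
    by (intro integrable_const_bound[of _ "(2 * C)\<^sup>2"]) auto
  note int\<phi> = integrable_diff_clipf_sq[OF assms(1) \<phi>] and int\<psi> = integrable_diff_clipf_sq[OF assms(2) \<psi>]
  have "excess_risk D f \<phi> \<le> (\<integral>z. 2 * (diff_clipf \<psi> z)\<^sup>2 + 2 * (\<phi> (fst z) - \<psi> (fst z))\<^sup>2 \<partial>D)"
    unfolding excess_risk_eq_clipf[OF assms(1) \<phi>]
  proof (rule integral_mono[OF int\<phi>])
    fix z
    have "(diff_clipf \<phi> z)\<^sup>2 = (diff_clipf \<psi> z - (\<phi> (fst z) - \<psi> (fst z)))\<^sup>2"
      by (simp add: diff_clipf_def[OF assms(1) \<phi>] diff_clipf_def[OF assms(2) \<psi>])
    also have "\<dots> \<le> 2 * (diff_clipf \<psi> z)\<^sup>2 + 2 * (\<phi> (fst z) - \<psi> (fst z))\<^sup>2"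
      using zero_le_power2[of "diff_clipf \<psi> z + (\<phi> (fst z) - \<psi> (fst z))"]
      by (simp add: power2_eq_square algebra_simps)
    finally show "(diff_clipf \<phi> z)\<^sup>2 \<le> 2 * (diff_clipf \<psi> z)\<^sup>2 + 2 * (\<phi> (fst z) - \<psi> (fst z))\<^sup>2" .
  qed (use int int\<psi> in auto)
  also have "\<dots> = 2 * excess_risk D f \<psi> + 2 * (\<integral>z. (\<phi> (fst z) - \<psi> (fst z))\<^sup>2 \<partial>D)"
    using int int\<psi> by (simp add: excess_risk_eq_clipf[OF assms(2) \<psi>])
  finally show ?thesis .
qed

text \<open>The squared l1 norm of the input is at most p times its squared Euclidean norm, so a
  second moment suffices even though the Lipschitz bound grows with the input.\<close>

lemma integral_sq_diff_le:
  assumes [measurable]: "\<phi> \<in> borel_measurable (input_space p)" "\<psi> \<in> borel_measurable (input_space p)"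
    and le: "\<And>x. \<bar>\<phi> x - \<psi> x\<bar> \<le> c * (1 + (\<Sum>j<p. \<bar>x j\<bar>))"
    and K: "(\<integral>\<^sup>+ z. ennreal (\<Sum>j<p. (fst z j)\<^sup>2) \<partial>D) \<le> ennreal (real p * K)" "0 \<le> K"
  shows "(\<integral>z. (\<phi> (fst z) - \<psi> (fst z))\<^sup>2 \<partial>D) \<le> c\<^sup>2 * (2 + 2 * (real p)\<^sup>2 * K)"
proof -
  note [measurable] = fst_measurable_D
  let ?q = "\<lambda>z. \<Sum>j<p. (fst z j)\<^sup>2"
  have "(\<lambda>x. \<Sum>j<p. (x j)\<^sup>2) \<in> borel_measurable (input_space p)"
    by (rule borel_measurable_sum) simp
  from measurable_compose[OF fst_measurable_D this] have q [measurable]: "?q \<in> borel_measurable D" .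
  have intq: "integrable D ?q"
    by (rule integrableI_nonneg) (use K in \<open>auto intro!: sum_nonneg le_less_trans[OF K(1)]\<close>)
  have "ennreal (\<integral>z. ?q z \<partial>D) \<le> ennreal (real p * K)"
    using K(1) by (subst (asm) nn_integral_eq_integral[OF intq]) (auto intro!: sum_nonneg)
  then have Eq: "(\<integral>z. ?q z \<partial>D) \<le> real p * K" using K by (subst (asm) ennreal_le_iff) auto
  have "(\<integral>z. (\<phi> (fst z) - \<psi> (fst z))\<^sup>2 \<partial>D) \<le> (\<integral>z. c\<^sup>2 * (2 + 2 * real p * ?q z) \<partial>D)"
  proof (rule integral_mono')
    fix z :: "(nat \<Rightarrow> real) \<times> real"
    let ?x = "fst z"
    have "(\<phi> ?x - \<psi> ?x)\<^sup>2 \<le> (c * (1 + (\<Sum>j<p. \<bar>?x j\<bar>)))\<^sup>2"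
      using power_mono[OF le[of ?x] abs_ge_zero, of 2] by simp
    also have "\<dots> = c\<^sup>2 * (1 + (\<Sum>j<p. \<bar>?x j\<bar>))\<^sup>2" by (simp add: power_mult_distrib)
    also have "\<dots> \<le> c\<^sup>2 * (2 + 2 * (\<Sum>j<p. \<bar>?x j\<bar>)\<^sup>2)"
    proof (rule mult_left_mono)
      have "0 \<le> (1 - (\<Sum>j<p. \<bar>?x j\<bar>))\<^sup>2" by simp
      then show "(1 + (\<Sum>j<p. \<bar>?x j\<bar>))\<^sup>2 \<le> 2 + 2 * (\<Sum>j<p. \<bar>?x j\<bar>)\<^sup>2"
        by (simp add: power2_eq_square algebra_simps)
    qed simp
    also have "\<dots> \<le> c\<^sup>2 * (2 + 2 * real p * ?q z)"
      using sum_squared_le_sum_of_squares[of "\<lambda>j. \<bar>?x j\<bar>" "{..<p}"]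
      by (intro mult_left_mono) (simp_all add: mult_ac)
    finally show "(\<phi> ?x - \<psi> ?x)\<^sup>2 \<le> c\<^sup>2 * (2 + 2 * real p * ?q z)" .
  qed (use intq in \<open>auto intro!: mult_nonneg_nonneg add_nonneg_nonneg sum_nonneg\<close>)
  also have "\<dots> = c\<^sup>2 * (2 + 2 * real p * (\<integral>z. ?q z \<partial>D))"
    using intq by (simp add: prob_space)
  also have "\<dots> \<le> c\<^sup>2 * (2 + 2 * real p * (real p * K))"
    by (intro mult_left_mono add_left_mono Eq) auto
  finally show ?thesis by (simp add: power2_eq_square mult_ac)
qed

text \<open>The coefficients are the values of \<tau> + |\<tau>|/3 at \<tau> = -t and \<tau> =
  t.\<close>

lemma gibbs_setup_prior:
  assumes "1 \<le> L" "1 \<le> B" "0 < t" "t \<le> 1 / bernstein_scale C \<sigma> \<Gamma>"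
  shows "gibbs_setup D (prior B p r L)
    (\<lambda>\<theta> z. (snd z - clipped_net C p r L \<theta> (fst z))\<^sup>2) (\<lambda>z. (snd z - f (fst z))\<^sup>2)
    (\<lambda>\<theta>. excess_risk D f (clipped_net C p r L \<theta>)) t (2 / 3) (4 / 3)"
proof -
  interpret Pr: prob_space "prior B p r L" by (rule prob_space_prior) (use assms in auto)
  note [measurable] = fst_measurable_D
  have C0: "0 \<le> C" using C by simp
  have net: "clipped_net C p r L \<theta> \<in> borel_measurable (input_space p)" if "\<theta> \<in> space (param_space p r L)" for \<theta>
    using measurable_compose[OF measurable_Pair1'[OF that] clipped_net_measurable[OF assms(1)]] by simp
  have snd_D [measurable]: "snd \<in> borel_measurable D"
    by (simp add: measurable_cong_sets[OF sets_D refl])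
  have "(\<lambda>y. (fst y, fst (snd y))) \<in> measurable (prior B p r L \<Otimes>\<^sub>M D) (param_space p r L \<Otimes>\<^sub>M input_space p)"
    by measurable
  from measurable_compose[OF this clipped_net_measurable[OF assms(1)]]
  have [measurable]: "(\<lambda>y. clipped_net C p r L (fst y) (fst (snd y))) \<in> borel_measurable (prior B p r L \<Otimes>\<^sub>M D)"
    by simp
  have loss: "(\<lambda>(\<theta>, z). (snd z - clipped_net C p r L \<theta> (fst z))\<^sup>2) \<in> borel_measurable (prior B p r L \<Otimes>\<^sub>M D)"
    unfolding case_prod_beta' by measurable
  show ?thesis
  proof (unfold_locales, rule loss)
    show "(\<lambda>\<theta>. excess_risk D f (clipped_net C p r L \<theta>)) \<in> borel_measurable (prior B p r L)"
      unfolding excess_risk_def risk_def using borel_measurable_lebesgue_integral[OF loss] by measurable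
    fix \<theta> assume "\<theta> \<in> space (prior B p r L)"
    then have m: "clipped_net C p r L \<theta> \<in> borel_measurable (input_space p)" by (intro net) simp
    note mgf = loss_diff_mgf[OF m clipped_net_bound[OF C0]]
    show "(\<integral>\<^sup>+z. ennreal (exp (- t * ((snd z - clipped_net C p r L \<theta> (fst z))\<^sup>2 - (snd z - f (fst z))\<^sup>2))) \<partial>D)
        \<le> ennreal (exp (- (2 / 3) * t * excess_risk D f (clipped_net C p r L \<theta>)))"
      using mgf[of "- t"] assms by simp
    show "(\<integral>\<^sup>+z. ennreal (exp (t * ((snd z - clipped_net C p r L \<theta> (fst z))\<^sup>2 - (snd z - f (fst z))\<^sup>2))) \<partial>D)
        \<le> ennreal (exp (4 / 3 * t * excess_risk D f (clipped_net C p r L \<theta>)))"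
      using mgf[of t] assms by simp
  qed (use assms in auto)
qed

text \<open>The threshold \<open>N\<close> is obtained before n, \<delta>, the index set and the
  comparison point, so it is uniform in all of them.\<close>

lemma gibbs_posterior_oracle:
  assumes L: "1 \<le> L" and B: "1 \<le> B" and K: "1 \<le> K"
    and second_moment: "(\<integral>\<^sup>+ z. ennreal (\<Sum>j<p. (fst z j)\<^sup>2) \<partial>D) \<le> ennreal (real p * K)"
  obtains N :: nat where "\<And>n \<delta> I \<theta>'. N \<le> n \<Longrightarrow> 0 < \<delta> \<Longrightarrow> \<delta> < 1 \<Longrightarrow> I \<subseteq> param_idx p r L \<Longrightarrow> I \<noteq> {} \<Longrightarrow>
     \<theta>' \<in> support_set B p r L I \<Longrightarrow>
     ennreal (1 - \<delta>) \<le> (\<integral>\<^sup>+ S. emeasure (gibbs_posterior C B p r L (real n / bernstein_scale C \<sigma> \<Gamma>) n S)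
       {\<theta> \<in> space (param_space p r L). excess_risk D f (clipped_net C p r L \<theta>)
          \<le> 4 * excess_risk D f (clipped_net C p r L \<theta>')
            + (3 * bernstein_scale C \<sigma> \<Gamma> + 4) / real n
              * (real (card I) * real L * ln (real (max p n)) + ln (2 / \<delta>))} \<partial>PiM {..<n} (\<lambda>_. D))"
proof -
  let ?\<Xi> = "bernstein_scale C \<sigma> \<Gamma>"
  let ?net = "clipped_net C p r L"
  let ?P = "num_params p r L"
  have \<Xi>: "0 < ?\<Xi>"
    using C Gamma by (auto simp: bernstein_scale_def intro!: add_pos_nonneg)
  have C0: "0 \<le> C" using C by simp
  obtain M where M: "M \<ge> 0" and lip: "\<And>\<theta> \<theta>' x \<eta>. close_params B p r L \<eta> \<theta> \<theta>' \<Longrightarrow>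
     \<bar>?net \<theta> x - ?net \<theta>' x\<bar> \<le> M * \<eta> * (1 + (\<Sum>j<p. \<bar>x j\<bar>))"
    using clipped_net_lipschitz[of B L p r C] B L by auto
  \<comment> \<open>Chosen so that a box of radius 1/n changes the network by at most m2 / (2 n^2)
    in mean square, hence by at most 1 / (2 n) once n exceeds m2.\<close>
  define m2 where "m2 = 2 * M\<^sup>2 * (2 + 2 * (real p)\<^sup>2 * K)"
  \<comment> \<open>The summands serve, in turn, to bound the logarithm of the prior mass by 2 |I|
    ln n, to control the approximation error, and to ensure ln n >= 1, as 3 exceeds e.\<close>
  obtain N0 :: nat where N0: "4 * B * real ?P + m2 + 3 \<le> real N0"
    using real_arch_simple by blast
  have m2: "0 \<le> m2" using K unfolding m2_def by simp
  have BP: "0 < 4 * B * real ?P" using B num_params_pos[of p r L] by simp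
  show thesis
  proof (rule that[of N0])
    fix n I \<theta>' and \<delta> :: real
    assume n: "N0 \<le> n" and \<delta>: "0 < \<delta>" "\<delta> < 1" and I: "I \<subseteq> param_idx p r L" "I \<noteq> {}"
      and \<theta>': "\<theta>' \<in> support_set B p r L I"
    define b where b: "b = 4 * excess_risk D f (?net \<theta>')
       + (3 * ?\<Xi> + 4) / real n * (real (card I) * real L * ln (real (max p n)) + ln (2 / \<delta>))"
    have "real N0 \<le> real n" using n by simp
    with N0 m2 BP have nlarge: "4 * B * real ?P \<le> real n" "m2 \<le> real n" "3 \<le> real n"
      by linarith+
    then have n0: "0 < real n" by simp
    let ?t = "1 / ?\<Xi>" and ?\<eta> = "1 / real n"
    interpret gibbs_setup D "prior B p r L" "\<lambda>\<theta> z. (snd z - ?net \<theta> (fst z))\<^sup>2" "\<lambda>z. (snd z - f (fst z))\<^sup>2"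
      "\<lambda>\<theta>. excess_risk D f (?net \<theta>)" ?t "2 / 3" "4 / 3" n
      by (rule gibbs_setup_prior) (use L B \<Xi> in auto)
    define a where "a = (?\<eta> / (4 * B * real ?P)) ^ card I"
    have a0: "0 < a" unfolding a_def using n0 BP by (intro zero_less_power divide_pos_pos) auto
    have a_le: "ennreal a \<le> emeasure (prior B p r L) (param_ball B p r L ?\<eta> \<theta>')"
      unfolding a_def by (rule emeasure_prior_param_ball[OF B _ _ I \<theta>']) (use nlarge in auto)
    have ln_a: "ln (1 / a) \<le> 2 * (real (card I) * ln (real n))"
    proof -
      have "1 / a = (4 * B * real ?P * real n) ^ card I"
        by (simp add: a_def power_divide power_one_over mult.commute)
      then have "ln (1 / a) = real (card I) * ln (4 * B * real ?P * real n)"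
        using BP n0 by (simp add: ln_realpow)
      also have "ln (4 * B * real ?P * real n) = ln (4 * B * real ?P) + ln (real n)"
        using BP n0 by (intro ln_mult_pos)
      also have "\<dots> \<le> 2 * ln (real n)" using BP n0 nlarge by simp
      finally show ?thesis by (simp add: mult_left_mono)
    qed
    define s where "s = 2 * excess_risk D f (?net \<theta>') + 1 / real n"
    have net_meas: "?net \<theta> \<in> borel_measurable (input_space p)" if "\<theta> \<in> space (param_space p r L)" for \<theta>
      using measurable_compose[OF measurable_Pair1'[OF that] clipped_net_measurable[OF L]] by simp
    have s: "excess_risk D f (?net \<theta>) \<le> s" if \<theta>: "\<theta> \<in> param_ball B p r L ?\<eta> \<theta>'" for \<theta>
    proof -
      have m: "?net \<theta> \<in> borel_measurable (input_space p)" "?net \<theta>' \<in> borel_measurable (input_space p)"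
        using subsetD[OF sets.sets_into_space[OF param_ball_sets] \<theta>] \<theta>'
        by (simp_all add: net_meas support_set_def)
      have "(\<integral>z. (?net \<theta> (fst z) - ?net \<theta>' (fst z))\<^sup>2 \<partial>D) \<le> (M * ?\<eta>)\<^sup>2 * (2 + 2 * (real p)\<^sup>2 * K)"
        by (rule integral_sq_diff_le[OF m lip[OF param_ball_close[OF \<theta> \<theta>']] second_moment]) (use K in auto)
      also have "\<dots> = m2 / 2 * (?\<eta> * ?\<eta>)" by (simp add: m2_def power2_eq_square)
      also have "\<dots> \<le> real n / 2 * (?\<eta> * ?\<eta>)" using nlarge by (intro mult_right_mono) auto
      also have "\<dots> = ?\<eta> / 2" using n0 by simp
      finally show ?thesis
        using excess_risk_le_twice[OF m clipped_net_bound[OF C0] clipped_net_bound[OF C0]]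
        by (simp add: s_def)
    qed
    define W where "W = real (card I) * real L * ln (real (max p n)) + ln (2 / \<delta>)"
    have card1: "1 \<le> real (card I)"
      using I finite_subset[OF I(1) finite_param_idx] by (simp add: Suc_le_eq card_gt_0_iff)
    have ln_n: "1 \<le> ln (real n)"
    proof -
      have "exp 1 \<le> real n" using exp_le nlarge by linarith
      then show ?thesis using n0 by (simp add: ln_ge_iff)
    qed
    have W: "real (card I) * ln (real n) + ln (1 / \<delta>) \<le> W"
    proof -
      have "real (card I) * 1 * ln (real n) \<le> real (card I) * real L * ln (real (max p n))"
        using L n0 ln_n by (intro mult_mono) auto
      moreover have "ln (1 / \<delta>) \<le> ln (2 / \<delta>)" using \<delta> by (simp add: ln_div)
      ultimately show ?thesis by (simp add: W_def)
    qed
    have W1: "1 \<le> W"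
    proof -
      have "1 * 1 \<le> real (card I) * ln (real n)" by (intro mult_mono card1 ln_n) auto
      moreover have "0 \<le> ln (1 / \<delta>)" using \<delta> by simp
      ultimately show ?thesis using W by linarith
    qed
    \<comment> \<open>The excess risks of \<theta>' cancel since 4 * 2/3 = 2 * 4/3. The part 3 \<Xi>
      of the constant contributes 2 W, enough for both logarithms; the extra 4 absorbs the term 1/n
      of \<open>s\<close>, because W is at least one.\<close>
    have key: "ln (1 / a) + 2 * ln (1 / \<delta>) \<le> ?t * real n * (2 / 3 * b - 4 / 3 * s)"
    proof -
      have "2 / 3 * b - 4 / 3 * s = (2 / 3 * ((3 * ?\<Xi> + 4) * W) - 4 / 3) / real n"
        unfolding b W_def[symmetric] using n0 by (simp add: s_def field_simps)
      then have "?t * real n * (2 / 3 * b - 4 / 3 * s) = (2 * ?\<Xi> * W + (8 / 3 * W - 4 / 3)) / ?\<Xi>"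
        using n0 by (simp add: field_simps)
      also have "\<dots> \<ge> 2 * ?\<Xi> * W / ?\<Xi>" using W1 \<Xi> by (intro divide_right_mono) auto
      moreover have "2 * ?\<Xi> * W / ?\<Xi> = 2 * W" using \<Xi> by simp
      ultimately show ?thesis using W ln_a by linarith
    qed
    let ?G = "{\<theta> \<in> space (prior B p r L). excess_risk D f (?net \<theta>) \<le> b}"
    have G [measurable]: "?G \<in> sets (prior B p r L)" by measurable
    have "ennreal (1 - \<delta>) \<le> (\<integral>\<^sup>+S. (\<integral>\<^sup>+\<theta>. ennreal (weight S \<theta>) * indicator ?G \<theta> \<partial>prior B p r L)
              / (\<integral>\<^sup>+\<theta>. ennreal (weight S \<theta>) \<partial>prior B p r L) \<partial>Dn)"
      by (rule gibbs_good_bound[OF _ a0 a_le s \<delta> key]) auto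
    also have "\<dots> = (\<integral>\<^sup>+ S. emeasure (gibbs_posterior C B p r L (real n / ?\<Xi>) n S) ?G \<partial>Dn)"
    proof (rule nn_integral_cong)
      fix S assume S: "S \<in> space Dn"
      note [measurable] = weight_meas_slice[OF S]
      \<comment> \<open>The factor 1/n of the empirical risk turns \<lambda> = n / \<Xi> into t = 1
        / \<Xi>.\<close>
      have w: "exp (- (real n / ?\<Xi>) * emp_risk n S (?net \<theta>)) = weight S \<theta>" for \<theta>
        using n0 by (simp add: emp_risk_def weight_def)
      \<comment> \<open>The posterior is normalised by a Bochner integral, the abstract bound by a
        nonnegative one; bounded positive weights make the two agree.\<close>
      have int: "integrable (prior B p r L) (weight S)"
        by (rule prior.integrable_const_bound[of _ 1])
           (use weight_pos weight_le_1 in \<open>auto simp: abs_of_pos\<close>)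
      define Z where "Z = (\<integral>\<theta>. weight S \<theta> \<partial>prior B p r L)"
      have Z: "(\<integral>\<^sup>+\<theta>. ennreal (weight S \<theta>) \<partial>prior B p r L) = ennreal Z"
        unfolding Z_def by (rule nn_integral_eq_integral[OF int]) (simp add: weight_pos less_imp_le)
      have Z0: "0 < Z" using partition_pos[OF S] unfolding Z by simp
      have "emeasure (gibbs_posterior C B p r L (real n / ?\<Xi>) n S) ?G
          = (\<integral>\<^sup>+\<theta>. ennreal (weight S \<theta> / Z) * indicator ?G \<theta> \<partial>prior B p r L)"
        unfolding gibbs_posterior_def Let_def w Z_def[symmetric]
        by (rule emeasure_density) measurable
      also have "\<dots> = (\<integral>\<^sup>+\<theta>. ennreal (weight S \<theta>) * indicator ?G \<theta> / ennreal Z \<partial>prior B p r L)"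
        by (intro nn_integral_cong)
           (simp add: divide_ennreal[OF less_imp_le[OF weight_pos] Z0, symmetric] indicator_def)
      also have "\<dots> = (\<integral>\<^sup>+\<theta>. ennreal (weight S \<theta>) * indicator ?G \<theta> \<partial>prior B p r L) / ennreal Z"
        by (rule nn_integral_divide) measurable
      finally show "(\<integral>\<^sup>+\<theta>. ennreal (weight S \<theta>) * indicator ?G \<theta> \<partial>prior B p r L)
              / (\<integral>\<^sup>+\<theta>. ennreal (weight S \<theta>) \<partial>prior B p r L)
          = emeasure (gibbs_posterior C B p r L (real n / ?\<Xi>) n S) ?G"
        unfolding Z by simp
    qed
    finally show "ennreal (1 - \<delta>) \<le> (\<integral>\<^sup>+ S. emeasure (gibbs_posterior C B p r L (real n / ?\<Xi>) n S)
       {\<theta> \<in> space (param_space p r L). excess_risk D f (?net \<theta>)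
          \<le> 4 * excess_risk D f (?net \<theta>')
            + (3 * ?\<Xi> + 4) / real n * (real (card I) * real L * ln (real (max p n)) + ln (2 / \<delta>))} \<partial>Dn)"
      unfolding b space_prior .
  qed
qed

end

theorem theorem3p2:
  fixes C \<Gamma> \<sigma> :: real
  assumes "C \<ge> 1" and "\<sigma> > 0" and "\<Gamma> > 0"
  shows "\<exists>\<Xi>0 \<Xi>1. \<Xi>0 > 0 \<and> \<Xi>1 > 0 \<and>
    (\<forall>(p::nat) (r::nat) (L::nat) (K::real) (B::real)
        (D :: ((nat \<Rightarrow> real) \<times> real) measure) (f :: (nat \<Rightarrow> real) \<Rightarrow> real)
        (\<theta>star :: pidx set \<Rightarrow> (pidx \<Rightarrow> real)).
      1 \<le> p \<and> 1 \<le> r \<and> 1 \<le> L \<and> K \<ge> 1 \<and> B \<ge> 1 \<and>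
      prob_space D \<and> sets D = sets (input_space p \<Otimes>\<^sub>M borel) \<and>
      f \<in> borel_measurable (input_space p) \<and>
      \<comment> \<open>(1) E|X|^2 <= pK and ||f||_inf <= C\<close>
      (\<integral>\<^sup>+ z. ennreal (\<Sum>j<p. (fst z j)\<^sup>2) \<partial>D) \<le> ennreal (real p * K) \<and>
      (AE z in D. \<bar>f (fst z)\<bar> \<le> C) \<and>
      \<comment> \<open>Y = f(X) + eps with E[eps | X] = 0 a.s.\<close>
      integrable D (\<lambda>z. snd z - f (fst z)) \<and>
      (AE z in D. real_cond_exp D (vimage_algebra (space D) fst (input_space p))
                    (\<lambda>z. snd z - f (fst z)) z = 0) \<and>
      \<comment> \<open>(2) E[|eps|^k | X] <= k!/2 sigma^2 Gamma^(k-2) a.s., all k >= 2\<close>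
      (\<forall>k::nat. k \<ge> 2 \<longrightarrow>
         integrable D (\<lambda>z. \<bar>snd z - f (fst z)\<bar> ^ k) \<and>
         (AE z in D. real_cond_exp D (vimage_algebra (space D) fst (input_space p))
                       (\<lambda>z. \<bar>snd z - f (fst z)\<bar> ^ k) z
                     \<le> fact k / 2 * \<sigma>\<^sup>2 * \<Gamma> ^ (k - 2))) \<and>
      \<comment> \<open>oracle: theta*_I minimises R over S_I\<close>
      (\<forall>I. I \<subseteq> param_idx p r L \<and> I \<noteq> {} \<longrightarrow>
         \<theta>star I \<in> support_set B p r L I \<and>
         (\<forall>\<theta> \<in> support_set B p r L I.
            risk D (clipped_net C p r L (\<theta>star I)) \<le> risk D (clipped_net C p r L \<theta>)))
      \<longrightarrow>
      (\<exists>N::nat. \<forall>n \<ge> N. \<forall>\<delta>::real. 0 < \<delta> \<and> \<delta> < 1 \<longrightarrow>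
         (\<integral>\<^sup>+ S. emeasure (gibbs_posterior C B p r L (real n / \<Xi>0) n S)
                   {\<theta> \<in> space (param_space p r L).
                      excess_risk D f (clipped_net C p r L \<theta>)
                      \<le> (MIN I \<in> {I. I \<subseteq> param_idx p r L \<and> I \<noteq> {}}.
                            4 * excess_risk D f (clipped_net C p r L (\<theta>star I))
                            + \<Xi>1 / real n * (real (card I) * real L * ln (real (max p n))
                                               + ln (2 / \<delta>)))}
            \<partial>(PiM {..<n} (\<lambda>_. D)))
         \<ge> ennreal (1 - \<delta>)))"
proof -
  \<comment> \<open>Both constants depend on \<open>C\<close>, \<sigma> and \<Gamma> alone, as the
    order of quantifiers demands.\<close>
  let ?\<Xi>0 = "bernstein_scale C \<sigma> \<Gamma>" and ?\<Xi>1 = "3 * bernstein_scale C \<sigma> \<Gamma> + 4"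
  have pos: "0 < ?\<Xi>0"
    using assms by (auto simp: bernstein_scale_def intro!: add_pos_nonneg)
  show ?thesis
  proof (rule exI[of _ ?\<Xi>0], rule exI[of _ ?\<Xi>1], intro conjI allI impI, goal_cases)
    case (3 p r L K B D f \<theta>star)
    interpret bernstein_regression D p f C \<sigma> \<Gamma>
      by (intro bernstein_regression.intro bernstein_regression_axioms.intro) (use 3 assms in blast)+
    have h: "1 \<le> L" "1 \<le> B" "1 \<le> K"
      "(\<integral>\<^sup>+ z. ennreal (\<Sum>j<p. (fst z j)\<^sup>2) \<partial>D) \<le> ennreal (real p * K)"
      using 3 by blast+
    have star: "\<theta>star I \<in> support_set B p r L I" if "I \<subseteq> param_idx p r L" "I \<noteq> {}" for I
      using 3 that by (elim conjE) simp
    show ?case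
    proof (rule gibbs_posterior_oracle[OF h, of r], goal_cases)
      case (1 N)
      note N = 1
      show ?case
      proof (intro exI[of _ N] allI impI, elim conjE)
        fix n \<delta> assume n: "N \<le> n" and \<delta>: "0 < \<delta>" "\<delta> < (1::real)"
        let ?b = "\<lambda>I. 4 * excess_risk D f (clipped_net C p r L (\<theta>star I))
          + ?\<Xi>1 / real n * (real (card I) * real L * ln (real (max p n)) + ln (2 / \<delta>))"
        let ?F = "{I. I \<subseteq> param_idx p r L \<and> I \<noteq> {}}"
        have fin: "finite ?F" by (rule finite_subset[of _ "Pow (param_idx p r L)"]) auto
        have "param_idx p r L \<in> ?F" by simp
        then have "?F \<noteq> {}" by blast
        with fin have "(MIN I \<in> ?F. ?b I) \<in> ?b ` ?F"
          by (intro Min_in finite_imageI) simp_all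
        \<comment> \<open>The minimum is attained at an index set that does not depend on the
          sample, so its event is the one for this single \<open>I\<close> and no union bound
          arises.\<close>
        then obtain I where eq: "(MIN I \<in> ?F. ?b I) = ?b I" and I: "I \<in> ?F" by (rule imageE)
        from I have "I \<subseteq> param_idx p r L" "I \<noteq> {}" by auto
        note this star[OF this]
        from N[OF n \<delta> this]
        show "ennreal (1 - \<delta>) \<le> (\<integral>\<^sup>+ S. emeasure (gibbs_posterior C B p r L (real n / ?\<Xi>0) n S)
           {\<theta> \<in> space (param_space p r L). excess_risk D f (clipped_net C p r L \<theta>) \<le> (MIN I \<in> ?F. ?b I)}
             \<partial>PiM {..<n} (\<lambda>_. D))"
          unfolding eq .
      qed
    qed
  qed (use pos in auto)
qed

end
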